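(* Let $p(x,s)$ be a joint PMF on finite alphabets $\mathcal X\times\mathcal S$, let $\hat{\mathcal X}$ be a finite reconstruction alphabet with distortion measure $d:\mathcal X\times\hat{\mathcal X}\to[0,\infty)$, let $D$ be a distortion constraint, and let $\mathcal T$ be the set of all mappings $t:\mathcal S\to\hat{\mathcal X}$. Consider the Wyner-Ziv rate-distortion problem (P), with variables $q(t|x)$, $x\in\mathcal X,t\in\mathcal T$: $$\begin{array}{ll}\text{minimize}&\sum_{x,s,t}p(x,s)q(t|x)\log\frac{q(t|x)}{Q(t|s)}\\ \text{subject to}&\sum_t q(t|x)=1\ \ \forall x,\\ &\sum_{x,s,t}p(x,s)q(t|x)\,d(x,t(s))\le D,\\ & q(t|x)\ge0\ \ \forall x,t,\end{array}$$ where $Q(t|s)=\frac{\sum_x p(x,s)q(t|x)}{\sum_x p(x,s)}$. Its optimal value is the Wyner-Ziv rate-distortion function $R(D)$. Then the Lagrange dual of (P) is (i.e. is equivalent to, with the same optimal value) the following geometric program in convex form, with variables $\boldsymbol\alpha\in\mathbb R^{|\mathcal X|}$, $\gamma\in\mathbb R_+$, $\mathbf y\in\mathbb R^{|\mathcal X||\mathcal S||\mathcal T|}$: $$\begin{array}{ll}\text{maximize}&\sum_x p(x)\alpha_x-\gamma D\\ \text{subject to}&\alpha_x+\sum_s p(s|x)\Big[\log p(x|s)-\gamma d(x,t(s))-y_{x,s,t}\Big]\le0\quad\forall x,t,\\ &\log\Big(\sum_x\exp\{y_{x,s,t}\}\Big)\le0\quad\forall s,t,\\ &\gamma\ge0.\end{array}$$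 Furthermore, if Slater's condition holds for (P), then strong duality holds and the solution of this geometric program is a tight lower bound on the solution of (P): its optimal value is $R(D)$.
   Context: Conventions: $\log$ is the natural logarithm, $0\log0=0$ (terms with weight $0$ are $0$); $p(x),p(s),p(s|x),p(x|s)$ are the marginals and conditionals of $p(x,s)$, and all $x\in\mathcal X$, $s\in\mathcal S$ have positive marginal probability. The Wyner-Ziv rate-distortion function is $R(D)=\min I(U;X|S)$ over $p(u|x)p(\hat x|u,s)$ with $\mathbb E[d(X,\hat X)]\le D$ for the joint law $p(x,s)p(u|x)p(\hat x|u,s)$; equivalently $R(D)=\min_{q(t|x)}I(T;X|S)$ over joint laws $p(x,s)q(t|x)$ with $\sum_{x,s,t}p(x,s)q(t|x)d(x,t(s))\le D$, which is problem (P). For a problem: minimize $f_0(\mathbf x)$ subject to $f_i(\mathbf x)\le0$ and $h_j(\mathbf x)=0$, the Lagrangian is $L(\mathbf x,\boldsymbol\lambda,\boldsymbol\mu)=f_0+\sum_i\lambda_if_i+\sum_j\mu_jh_j$, the Lagrange dual function is $g(\boldsymbol\lambda,\boldsymbol\mu)=\inf_{\mathbf x}L(\mathbf x,\boldsymbol\lambda,\boldsymbol\mu)$ (infimum over the domain of the problem), and the Lagrange dual problem is: maximize $g(\boldsymbol\lambda,\boldsymbol\mu)$ subject to $\lambda_i\ge0$ for all $i$. Strong duality means that the optimal values of the primal and the dual problem coincide. Slater's condition: there is a point in the relative interior of the domain satisfying the equality constraints and satisfying all inequality constraints strictly. A geometric program minimizes a posynomial (a finite sum of terms $c\,x_1^{a_1}\cdots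 x_n^{a_n}$ with $c>0$, $a_i\in\mathbb R$) subject to upper bounds by 1 on posynomials and monomial equalities; its convex form is obtained by a logarithmic change of variables and taking logarithms of objective and constraints. *)

theory Defs
  imports "HOL-Probability.Probability"
begin

section \<open>Optimization problems and Lagrange duality\<close>

text \<open>
  Minimize \<open>objective P\<close> over \<open>domain P\<close> subject to \<open>ineq P i v \<le> 0\<close> for \<open>i \<in> ineqs P\<close> and
  \<open>eqn P j v = 0\<close> for \<open>j \<in> eqns P\<close>.  The index sets are meant to be finite.
\<close>

record ('v, 'i, 'j) opt_problem =
  domain :: "'v set"
  objective :: "'v \<Rightarrow> real"
  ineqs :: "'i set"
  ineq :: "'i \<Rightarrow> 'v \<Rightarrow> real"
  eqns :: "'j set"
  eqn :: "'j \<Rightarrow> 'v \<Rightarrow> real"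

definition feasible :: "('v, 'i, 'j) opt_problem \<Rightarrow> 'v set" where
  "feasible P = {v \<in> domain P. (\<forall>i\<in>ineqs P. ineq P i v \<le> 0) \<and> (\<forall>j\<in>eqns P. eqn P j v = 0)}"

text \<open>Optimal values are extended reals; an infeasible problem has optimal value \<open>\<infinity>\<close>.\<close>

definition optimal_value :: "('v, 'i, 'j) opt_problem \<Rightarrow> ereal" where
  "optimal_value P = (INF v\<in>feasible P. ereal (objective P v))"

definition lagrangian ::
    "('v, 'i, 'j) opt_problem \<Rightarrow> 'v \<Rightarrow> ('i \<Rightarrow> real) \<Rightarrow> ('j \<Rightarrow> real) \<Rightarrow> real" where
  "lagrangian P v lam mu =
     objective P v + (\<Sum>i\<in>ineqs P. lam i * ineq P i v) + (\<Sum>j\<in>eqns P. mu j * eqn P j v)"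

definition dual_function ::
    "('v, 'i, 'j) opt_problem \<Rightarrow> ('i \<Rightarrow> real) \<Rightarrow> ('j \<Rightarrow> real) \<Rightarrow> ereal" where
  "dual_function P lam mu = (INF v\<in>domain P. ereal (lagrangian P v lam mu))"

definition dual_feasible :: "('v, 'i, 'j) opt_problem \<Rightarrow> (('i \<Rightarrow> real) \<times> ('j \<Rightarrow> real)) set" where
  "dual_feasible P = {(lam, mu). \<forall>i\<in>ineqs P. 0 \<le> lam i}"

definition dual_value :: "('v, 'i, 'j) opt_problem \<Rightarrow> ereal" where
  "dual_value P = (SUP (lam, mu)\<in>dual_feasible P. dual_function P lam mu)"

definition strong_duality :: "('v, 'i, 'j) opt_problem \<Rightarrow> bool" where
  "strong_duality P \<longleftrightarrow> optimal_value P = dual_value P"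

definition slater :: "('v::euclidean_space, 'i, 'j) opt_problem \<Rightarrow> bool" where
  "slater P \<longleftrightarrow> (\<exists>v\<in>rel_interior (domain P).
     (\<forall>i\<in>ineqs P. ineq P i v < 0) \<and> (\<forall>j\<in>eqns P. eqn P j v = 0))"


section \<open>Geometric programs in convex form\<close>

text \<open>The variables of a posynomial are the coordinates \<open>v \<bullet> b\<close>, \<open>b \<in> Basis\<close>.\<close>

definition monomial :: "('v::euclidean_space \<Rightarrow> real) \<Rightarrow> bool" where
  "monomial f \<longleftrightarrow> (\<exists>c>0. \<exists>a::'v. \<forall>v. (\<forall>b\<in>Basis. 0 < v \<bullet> b) \<longrightarrow>
     f v = c * (\<Prod>b\<in>Basis. (v \<bullet> b) powr (a \<bullet> b)))"

definition posynomial :: "('v::euclidean_space \<Rightarrow> real) \<Rightarrow> bool" where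
  "posynomial f \<longleftrightarrow> (\<exists>K>0. \<exists>m :: nat \<Rightarrow> 'v \<Rightarrow> real. (\<forall>k<K. monomial (m k)) \<and>
     (\<forall>v. (\<forall>b\<in>Basis. 0 < v \<bullet> b) \<longrightarrow> f v = (\<Sum>k<K. m k v)))"

definition exp_vec :: "'v::euclidean_space \<Rightarrow> 'v" where
  "exp_vec z = (\<Sum>b\<in>Basis. exp (z \<bullet> b) *\<^sub>R b)"

definition gp_convex_form :: "('v::euclidean_space, 'i, 'j) opt_problem \<Rightarrow> bool" where
  "gp_convex_form P \<longleftrightarrow>
     domain P = UNIV \<and> finite (ineqs P) \<and> finite (eqns P) \<and>
     (\<exists>f. posynomial f \<and> (\<forall>z. objective P z = ln (f (exp_vec z)))) \<and>
     (\<forall>i\<in>ineqs P. \<exists>f. posynomial f \<and> (\<forall>z. ineq P i z = ln (f (exp_vec z)))) \<and>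
     (\<forall>j\<in>eqns P. \<exists>f. monomial f \<and> (\<forall>z. eqn P j z = ln (f (exp_vec z))))"


section \<open>The Wyner-Ziv rate-distortion function\<close>

text \<open>The joint law of \<open>(X, S, U, X\<^sub>h\<^sub>a\<^sub>t)\<close>, that is \<open>p(x,s) p(u|x) p(x\<^sub>h\<^sub>a\<^sub>t|u,s)\<close>.\<close>

definition wz_law ::
    "('x \<times> 's) pmf \<Rightarrow> ('x \<Rightarrow> 'u pmf) \<Rightarrow> ('u \<Rightarrow> 's \<Rightarrow> 'r pmf) \<Rightarrow> ('x \<times> 's \<times> 'u \<times> 'r) pmf" where
  "wz_law p W V =
     bind_pmf p (\<lambda>(x, s). bind_pmf (W x) (\<lambda>u. map_pmf (\<lambda>r. (x, s, u, r)) (V u s)))"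

text \<open>\<open>I(U;X|S)\<close> in nats.\<close>

definition wz_rate :: "('x \<times> 's \<times> 'u \<times> 'r) pmf \<Rightarrow> real" where
  "wz_rate J = prob_space.conditional_mutual_information (measure_pmf J) (exp 1)
     (count_space UNIV) (count_space UNIV) (count_space UNIV)
     (\<lambda>(x, s, u, r). u) (\<lambda>(x, s, u, r). x) (\<lambda>(x, s, u, r). s)"

text \<open>
  The auxiliary variable \<open>U\<close> ranges over arbitrary finite alphabets, encoded as finite subsets
  of \<^typ>\<open>nat\<close>: each \<open>p(\<cdot>|x)\<close> is a PMF on \<^typ>\<open>nat\<close> of finite support.
\<close>

definition wyner_ziv :: "('x::finite \<times> 's::finite) pmf \<Rightarrow> ('x \<Rightarrow> 'r::finite \<Rightarrow> real) \<Rightarrow> real \<Rightarrow> ereal"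
  where
  "wyner_ziv p d D =
     Inf {ereal (wz_rate (wz_law p W V)) | (W :: 'x \<Rightarrow> nat pmf) (V :: nat \<Rightarrow> 's \<Rightarrow> 'r pmf).
       (\<forall>x. finite (set_pmf (W x))) \<and>
       measure_pmf.expectation (wz_law p W V) (\<lambda>(x, s, u, r). d x r) \<le> D}"


section \<open>The convex problem over test channels \<open>q(t|x)\<close>\<close>

definition prob_x :: "('x \<times> 's) pmf \<Rightarrow> 'x \<Rightarrow> real" where
  "prob_x p x = pmf (map_pmf fst p) x"

definition prob_s :: "('x \<times> 's) pmf \<Rightarrow> 's \<Rightarrow> real" where
  "prob_s p s = pmf (map_pmf snd p) s"

text \<open>\<open>p(s|x)\<close> and \<open>p(x|s)\<close>.\<close>

definition prob_s_given_x :: "('x \<times> 's) pmf \<Rightarrow> 's \<Rightarrow> 'x \<Rightarrow> real" where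
  "prob_s_given_x p s x = pmf p (x, s) / prob_x p x"

definition prob_x_given_s :: "('x \<times> 's) pmf \<Rightarrow> 'x \<Rightarrow> 's \<Rightarrow> real" where
  "prob_x_given_s p x s = pmf p (x, s) / prob_s p s"

text \<open>
  The variable \<open>q(t|x)\<close> is \<open>q $ x $ t\<close>; the index \<open>t\<close> ranges over all functions \<open>'s \<Rightarrow> 'r\<close>.
  Since \<^prop>\<open>ln 0 = (0::real)\<close>, and \<open>Q(t|s) = 0\<close> forces \<open>p(x,s) q(t|x) = 0\<close> for nonnegative
  \<open>q\<close>, the convention \<open>0 log 0 = 0\<close> holds in the objective.
\<close>

definition wz_Q :: "('x::finite \<times> 's::finite) pmf \<Rightarrow> real^('s \<Rightarrow> 'r::finite)^'x \<Rightarrow> ('s \<Rightarrow> 'r) \<Rightarrow> 's \<Rightarrow> real"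
  where
  "wz_Q p q t s = (\<Sum>x\<in>UNIV. pmf p (x, s) * q $ x $ t) / (\<Sum>x\<in>UNIV. pmf p (x, s))"

definition wz_objective :: "('x::finite \<times> 's::finite) pmf \<Rightarrow> real^('s \<Rightarrow> 'r::finite)^'x \<Rightarrow> real" where
  "wz_objective p q =
     (\<Sum>x\<in>UNIV. \<Sum>s\<in>UNIV. \<Sum>t\<in>UNIV. pmf p (x, s) * q $ x $ t * ln (q $ x $ t / wz_Q p q t s))"

definition wz_distortion ::
    "('x::finite \<times> 's::finite) pmf \<Rightarrow> ('x \<Rightarrow> 'r::finite \<Rightarrow> real) \<Rightarrow> real^('s \<Rightarrow> 'r)^'x \<Rightarrow> real" where
  "wz_distortion p d q =
     (\<Sum>x\<in>UNIV. \<Sum>s\<in>UNIV. \<Sum>t\<in>UNIV. pmf p (x, s) * q $ x $ t * d x (t s))"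

text \<open>
  The domain is the nonnegative orthant, where the objective is defined.  Nonnegativity is also
  an explicit inequality constraint with its own multipliers.
\<close>

datatype ('x, 't) wz_ineq = Distortion | Nonneg 'x 't

definition wz_problem ::
    "('x::finite \<times> 's::finite) pmf \<Rightarrow> ('x \<Rightarrow> 'r::finite \<Rightarrow> real) \<Rightarrow> real \<Rightarrow>
      (real^('s \<Rightarrow> 'r)^'x, ('x, 's \<Rightarrow> 'r) wz_ineq, 'x) opt_problem" where
  "wz_problem p d D = \<lparr>
     domain = {q. \<forall>x t. 0 \<le> q $ x $ t},
     objective = wz_objective p,
     ineqs = UNIV,
     ineq = (\<lambda>i q. case i of Distortion \<Rightarrow> wz_distortion p d q - D | Nonneg x t \<Rightarrow> - q $ x $ t),
     eqns = UNIV,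
     eqn = (\<lambda>x q. (\<Sum>t\<in>UNIV. q $ x $ t) - 1)\<rparr>"


section \<open>The geometric program\<close>

text \<open>
  The variables are triples \<open>(\<alpha>, \<gamma>, y)\<close> with \<open>y\<^sub>x\<^sub>,\<^sub>s\<^sub>,\<^sub>t\<close> rendered as \<open>y $ x $ s $ t\<close>.  The
  objective is to be maximized; in the standard (minimization) form of a geometric program its
  negative is minimized.
\<close>

type_synonym ('x, 's, 'r) gp_var = "(real^'x) \<times> real \<times> (real^('s \<Rightarrow> 'r)^'s^'x)"

definition wz_gp_objective ::
    "('x::finite \<times> 's::finite) pmf \<Rightarrow> real \<Rightarrow> ('x, 's, 'r::finite) gp_var \<Rightarrow> real" where
  "wz_gp_objective p D = (\<lambda>(\<alpha>, \<gamma>, y). (\<Sum>x\<in>UNIV. prob_x p x * \<alpha> $ x) - \<gamma> * D)"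

datatype ('x, 's, 't) gp_ineq = Alpha 'x 't | LogSumExp 's 't | GammaNonneg

definition wz_gp ::
    "('x::finite \<times> 's::finite) pmf \<Rightarrow> ('x \<Rightarrow> 'r::finite \<Rightarrow> real) \<Rightarrow> real \<Rightarrow>
      (('x, 's, 'r) gp_var, ('x, 's, 's \<Rightarrow> 'r) gp_ineq, unit) opt_problem" where
  "wz_gp p d D = \<lparr>
     domain = UNIV,
     objective = (\<lambda>v. - wz_gp_objective p D v),
     ineqs = UNIV,
     ineq = (\<lambda>i (\<alpha>, \<gamma>, y). case i of
         Alpha x t \<Rightarrow> \<alpha> $ x + (\<Sum>s\<in>UNIV. prob_s_given_x p s x *
           (ln (prob_x_given_s p x s) - \<gamma> * d x (t s) - y $ x $ s $ t))
       | LogSumExp s t \<Rightarrow> ln (\<Sum>x\<in>UNIV. exp (y $ x $ s $ t))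
       | GammaNonneg \<Rightarrow> - \<gamma>),
     eqns = {},
     eqn = (\<lambda>_ _. 0)\<rparr>"

definition wz_gp_value ::
    "('x::finite \<times> 's::finite) pmf \<Rightarrow> ('x \<Rightarrow> 'r::finite \<Rightarrow> real) \<Rightarrow> real \<Rightarrow> ereal" where
  "wz_gp_value p d D = (SUP v\<in>feasible (wz_gp p d D). ereal (wz_gp_objective p D v))"

text \<open>
  Equivalence of the Lagrange dual of \<open>wz_problem\<close> with the geometric program, besides equality of the
  optimal values: under \<open>\<mu>\<^sub>x = - p(x) \<alpha>\<^sub>x\<close>, with \<open>\<gamma>\<close> the multiplier of the distortion constraint,
  feasible points are carried to dual feasible points (nonnegativity multipliers \<open>0\<close>) with the
  same objective value, and conversely.  The converse allows an arbitrarily small decrease of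
  \<open>\<alpha>\<close>: if \<open>p(x,s) = 0\<close> for some \<open>x\<close>, \<open>s\<close>, the constraint on \<open>\<Sum>\<^sub>x exp y\<^sub>x\<^sub>,\<^sub>s\<^sub>,\<^sub>t\<close> may be satisfiable
  only in the limit \<open>y\<^sub>x\<^sub>,\<^sub>s\<^sub>,\<^sub>t \<rightarrow> -\<infinity>\<close>.
\<close>

definition wz_dual_equiv_gp ::
    "('x::finite \<times> 's::finite) pmf \<Rightarrow> ('x \<Rightarrow> 'r::finite \<Rightarrow> real) \<Rightarrow> real \<Rightarrow> bool" where
  "wz_dual_equiv_gp p d D \<longleftrightarrow>
     (\<forall>\<alpha> \<gamma> y. (\<alpha>, \<gamma>, y) \<in> feasible (wz_gp p d D) \<longrightarrow>
        (let lam = case_wz_ineq \<gamma> (\<lambda>_ _. 0); mu = (\<lambda>x. - prob_x p x * \<alpha> $ x)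
         in (lam, mu) \<in> dual_feasible (wz_problem p d D) \<and>
            dual_function (wz_problem p d D) lam mu = ereal (wz_gp_objective p D (\<alpha>, \<gamma>, y)))) \<and>
     (\<forall>lam mu. (lam, mu) \<in> dual_feasible (wz_problem p d D) \<and>
               dual_function (wz_problem p d D) lam mu \<noteq> - \<infinity> \<longrightarrow>
        (let \<alpha> = (\<chi> x. - mu x / prob_x p x); \<gamma> = lam Distortion
         in (\<forall>y :: real^('s \<Rightarrow> 'r)^'s^'x.
               dual_function (wz_problem p d D) lam mu = ereal (wz_gp_objective p D (\<alpha>, \<gamma>, y))) \<and>
            (\<forall>\<epsilon>>0. \<exists>y. ((\<chi> x. \<alpha> $ x - \<epsilon>), \<gamma>, y) \<in> feasible (wz_gp p d D)))) \<and>
     dual_value (wz_problem p d D) = wz_gp_value p d D"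

end

theory Submission
  imports Defs
begin

text \<open>
  The Lagrangian splits into a sum over the maps \<open>t\<close> of positively homogeneous convex functions
  of \<open>q(t|\<cdot>)\<close>, plus the constant \<open>- \<gamma> D - \<Sum>\<^sub>x \<mu>\<^sub>x\<close>.  So the dual function is that constant
  if each summand is nonnegative on the orthant, and \<open>-\<infinity>\<close> otherwise.  By the log-sum
  inequality, \<open>\<Sum>\<^sub>x\<^sub>,\<^sub>s p(x,s) q\<^sub>x log (q\<^sub>x / Q\<^sub>s)\<close> is the supremum of the linear functionals
  \<open>\<Sum>\<^sub>x\<^sub>,\<^sub>s p(x,s) q\<^sub>x (y\<^sub>x\<^sub>,\<^sub>s - log p(x|s))\<close> over all \<open>y\<close> with \<open>\<Sum>\<^sub>x exp y\<^sub>x\<^sub>,\<^sub>s \<le> 1\<close>, and a separation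
  argument exchanges this supremum with the infimum over \<open>q\<close>; the \<open>y\<close> are the variables of the
  geometric program.  Strong duality is the usual separation of the optimal value from the
  perturbation set.  Finally, replacing \<open>U\<close> by a random map \<open>T\<close> that is drawn from \<open>U\<close> with
  independent components \<open>T(s) \<sim> p(\<cdot>|u,s)\<close> keeps the distortion and, by convexity, does not
  increase the rate.
\<close>


section \<open>The rate contributed by a single map\<close>

text \<open>The function a ln (a / b) is convex and homogeneous of degree 1; the left side is its
  tangent plane along the ray a = c b. The bound is ln z \<le> z - 1 at z = c b / a.\<close>

lemma ln_tangent_le:
  fixes a b c :: real
  assumes "0 \<le> a" "0 \<le> b" "b = 0 \<Longrightarrow> a = 0" "0 < c"
  shows "a * ln c + a - c * b \<le> a * ln (a / b)"
proof (cases "a = 0")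
  case True
  then show ?thesis using assms by simp
next
  case False
  then have a: "0 < a" and b: "0 < b" using assms by (auto simp: less_le)
  have "ln (c * b / a) \<le> c * b / a - 1"
    using a b assms by (intro ln_le_minus_one) auto
  then have "a * ln (c * b / a) \<le> a * (c * b / a - 1)"
    using a by (intro mult_left_mono) auto
  then show ?thesis
    using a b assms by (simp add: ln_div ln_mult algebra_simps)
qed

text \<open>Every summand is bounded below by its tangent with one common slope \<open>c\<close>,
  the ratio of the totals; the linear parts then cancel in the sum. An infinite index set or a zero
  total makes both sides 0.\<close>

lemma log_sum_inequality:
  fixes a b :: "'a \<Rightarrow> real"
  assumes a: "\<And>i. i \<in> I \<Longrightarrow> 0 \<le> a i" and b: "\<And>i. i \<in> I \<Longrightarrow> 0 \<le> b i"
    and ab: "\<And>i. i \<in> I \<Longrightarrow> b i = 0 \<Longrightarrow> a i = 0"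
  shows "sum a I * ln (sum a I / sum b I) \<le> (\<Sum>i\<in>I. a i * ln (a i / b i))"
proof (cases "finite I \<and> sum a I \<noteq> 0")
  case False
  then show ?thesis
    using a by (auto simp: sum_nonneg_eq_0_iff)
next
  case True
  then have fin: "finite I" by simp
  have apos: "0 < sum a I"
    using True a by (simp add: order_less_le sum_nonneg)
  have bpos: "0 < sum b I"
  proof (rule ccontr)
    assume "\<not> 0 < sum b I"
    then have "sum b I = 0" using sum_nonneg[of I b] b by force
    then have "\<forall>i\<in>I. b i = 0" using fin b by (simp add: sum_nonneg_eq_0_iff)
    then have "\<forall>i\<in>I. a i = 0" using ab by blast
    then show False using apos by simp
  qed
  define c where "c = sum a I / sum b I"
  have c: "0 < c" using apos bpos by (simp add: c_def)
  have "(\<Sum>i\<in>I. a i * ln c + a i - c * b i) \<le> (\<Sum>i\<in>I. a i * ln (a i / b i))"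
    using a b ab c by (intro sum_mono ln_tangent_le) auto
  moreover have "(\<Sum>i\<in>I. a i * ln c + a i - c * b i) = sum a I * ln c + sum a I - c * sum b I"
    by (simp add: sum.distrib sum_subtractf sum_distrib_left sum_distrib_right)
  moreover have "c * sum b I = sum a I" using bpos by (simp add: c_def)
  ultimately show ?thesis by (simp add: c_def)
qed

section \<open>Marginals and the splitting into slices\<close>

lemma prob_s_eq_sum: "prob_s p s = (\<Sum>x\<in>UNIV. pmf p (x, s))"
  for p :: "('x::finite \<times> 's) pmf"
proof -
  have "prob_s p s = measure p (snd -` {s})"
    by (simp add: prob_s_def pmf_map)
  also have "snd -` {s} = (\<lambda>x. (x, s)) ` (UNIV :: 'x set)" by auto
  also have "measure p \<dots> = (\<Sum>x\<in>UNIV. pmf p (x, s))"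
    by (subst measure_measure_pmf_finite) (auto simp: sum.reindex inj_on_def)
  finally show ?thesis .
qed

lemma prob_x_eq_sum: "prob_x p x = (\<Sum>s\<in>UNIV. pmf p (x, s))"
  for p :: "('x \<times> 's::finite) pmf"
proof -
  have "prob_x p x = measure p (fst -` {x})"
    by (simp add: prob_x_def pmf_map)
  also have "fst -` {x} = (\<lambda>s. (x, s)) ` (UNIV :: 's set)" by auto
  also have "measure p \<dots> = (\<Sum>s\<in>UNIV. pmf p (x, s))"
    by (subst measure_measure_pmf_finite) (auto simp: sum.reindex inj_on_def)
  finally show ?thesis .
qed

text \<open>Here \<open>v x\<close> stands for \<open>q(t|x)\<close> with \<open>t\<close> fixed.\<close>

definition wz_slice :: "('x::finite \<times> 's::finite) pmf \<Rightarrow> ('x \<Rightarrow> real) \<Rightarrow> real" where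
  "wz_slice p v = (\<Sum>x\<in>UNIV. \<Sum>s\<in>UNIV.
     pmf p (x, s) * v x * ln (v x / ((\<Sum>x'\<in>UNIV. pmf p (x', s) * v x') / prob_s p s)))"

lemma wz_objective_eq_slices:
  "wz_objective p q = (\<Sum>t\<in>UNIV. wz_slice p (\<lambda>x. q $ x $ t))"
proof -
  have "wz_objective p q =
      (\<Sum>x\<in>UNIV. \<Sum>t\<in>UNIV. \<Sum>s\<in>UNIV. pmf p (x, s) * q $ x $ t * ln (q $ x $ t / wz_Q p q t s))"
    unfolding wz_objective_def by (intro sum.cong refl sum.swap)
  also have "\<dots> =
      (\<Sum>t\<in>UNIV. \<Sum>x\<in>UNIV. \<Sum>s\<in>UNIV. pmf p (x, s) * q $ x $ t * ln (q $ x $ t / wz_Q p q t s))"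
    by (rule sum.swap)
  finally show ?thesis
    by (simp add: wz_slice_def wz_Q_def prob_s_eq_sum)
qed

lemma wz_distortion_eq_slices:
  "wz_distortion p d q = (\<Sum>t\<in>UNIV. \<Sum>x\<in>UNIV. (\<Sum>s\<in>UNIV. pmf p (x, s) * d x (t s)) * q $ x $ t)"
proof -
  have "wz_distortion p d q =
      (\<Sum>x\<in>UNIV. \<Sum>t\<in>UNIV. \<Sum>s\<in>UNIV. pmf p (x, s) * q $ x $ t * d x (t s))"
    unfolding wz_distortion_def by (intro sum.cong refl sum.swap)
  also have "\<dots> =
      (\<Sum>t\<in>UNIV. \<Sum>x\<in>UNIV. \<Sum>s\<in>UNIV. pmf p (x, s) * q $ x $ t * d x (t s))"
    by (rule sum.swap)
  finally show ?thesis by (simp add: sum_distrib_left sum_distrib_right mult_ac)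
qed

section \<open>Homogeneity, convexity and linear lower bounds of a slice\<close>

lemma wz_slice_zero: "wz_slice p (\<lambda>x. 0) = 0"
  by (simp add: wz_slice_def)

text \<open>The ratio inside the logarithm is invariant under scaling. This homogeneity is what
  makes the dual function either an explicit constant or -\<infinity>.\<close>

lemma wz_slice_scale:
  assumes c: "0 < c"
  shows "wz_slice p (\<lambda>x. c * v x) = c * wz_slice p v"
proof -
  have "(\<Sum>x'\<in>UNIV. pmf p (x', s) * (c * v x')) = c * (\<Sum>x'\<in>UNIV. pmf p (x', s) * v x')" for s
    by (simp add: sum_distrib_left mult_ac)
  then have "c * v x / ((\<Sum>x'\<in>UNIV. pmf p (x', s) * (c * v x')) / prob_s p s) =
      v x / ((\<Sum>x'\<in>UNIV. pmf p (x', s) * v x') / prob_s p s)" for x s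
    using c by simp
  then show ?thesis
    unfolding wz_slice_def by (simp only:) (simp add: sum_distrib_left mult_ac)
qed

text \<open>This supplies the absolute continuity that the log-sum inequality asks for.\<close>

lemma joint_weight_eq_0:
  fixes p :: "('x::finite \<times> 's) pmf"
  assumes "\<And>x. 0 \<le> v x" "(\<Sum>x'\<in>UNIV. pmf p (x', s) * v x') = 0"
  shows "pmf p (x, s) * v x = 0"
  using assms by (subst (asm) sum_nonneg_eq_0_iff) auto

text \<open>For each pair (x, s) this is the log-sum inequality over \<open>u\<close>, since Q is
  linear in the vector. Two indices give convexity of the objective; a whole alphabet gives the
  comparison of U with a random map.\<close>

lemma wz_slice_sum_le:
  fixes p :: "('x::finite \<times> 's::finite) pmf" and v :: "'u \<Rightarrow> 'x \<Rightarrow> real"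
  assumes v: "\<And>u x. 0 \<le> v u x" and k: "\<And>u. u \<in> A \<Longrightarrow> 0 \<le> k u" and ps: "\<And>s. 0 < prob_s p s"
  shows "wz_slice p (\<lambda>x. \<Sum>u\<in>A. k u * v u x) \<le> (\<Sum>u\<in>A. k u * wz_slice p (v u))"
proof -
  define Q where "Q w s = (\<Sum>x\<in>UNIV. pmf p (x, s) * w x) / prob_s p s" for w s
  have Q: "Q (\<lambda>x. \<Sum>u\<in>A. k u * v u x) s = (\<Sum>u\<in>A. k u * Q (v u) s)" for s
  proof -
    have "(\<Sum>x\<in>UNIV. pmf p (x, s) * (\<Sum>u\<in>A. k u * v u x)) =
        (\<Sum>x\<in>UNIV. \<Sum>u\<in>A. k u * (pmf p (x, s) * v u x))"
      by (simp add: sum_distrib_left mult_ac)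
    also have "\<dots> = (\<Sum>u\<in>A. k u * (\<Sum>x\<in>UNIV. pmf p (x, s) * v u x))"
      by (subst sum.swap) (simp add: sum_distrib_left)
    finally show ?thesis by (simp add: Q_def sum_divide_distrib[where A = A])
  qed
  have Qnn: "0 \<le> Q (v u) s" for u s
    unfolding Q_def using v ps[of s] by (intro divide_nonneg_pos sum_nonneg) auto
  have Q0: "pmf p (x, s) = 0 \<or> v u x = 0" if "Q (v u) s = 0" for u x s
    using that v joint_weight_eq_0[where v = "v u" and p = p and s = s and x = x] ps[of s]
    by (auto simp: Q_def)
  have termwise: "pmf p (x, s) * (\<Sum>u\<in>A. k u * v u x) *
        ln ((\<Sum>u\<in>A. k u * v u x) / (\<Sum>u\<in>A. k u * Q (v u) s))
      \<le> (\<Sum>u\<in>A. k u * (pmf p (x, s) * v u x * ln (v u x / Q (v u) s)))" for x s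
  \<comment> \<open>Where p(x, s) = 0 a vanishing Q does not force v = 0, so the log-sum inequality
    is applied only where p(x, s) is positive.\<close>
  proof (cases "pmf p (x, s) = 0")
    case False
    have "(\<Sum>u\<in>A. k u * v u x) * ln ((\<Sum>u\<in>A. k u * v u x) / (\<Sum>u\<in>A. k u * Q (v u) s))
      \<le> (\<Sum>u\<in>A. (k u * v u x) * ln ((k u * v u x) / (k u * Q (v u) s)))"
      using v k Qnn False by (intro log_sum_inequality) (auto dest: Q0)
    also have "\<dots> = (\<Sum>u\<in>A. k u * (v u x * ln (v u x / Q (v u) s)))"
    proof (intro sum.cong refl)
      fix u
      show "(k u * v u x) * ln ((k u * v u x) / (k u * Q (v u) s)) = k u * (v u x * ln (v u x / Q (v u) s))"
        by (cases "k u = 0") auto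
    qed
    finally have "pmf p (x, s) * ((\<Sum>u\<in>A. k u * v u x) *
        ln ((\<Sum>u\<in>A. k u * v u x) / (\<Sum>u\<in>A. k u * Q (v u) s)))
      \<le> pmf p (x, s) * (\<Sum>u\<in>A. k u * (v u x * ln (v u x / Q (v u) s)))"
      by (rule mult_left_mono) simp
    also have "\<dots> = (\<Sum>u\<in>A. k u * (pmf p (x, s) * v u x * ln (v u x / Q (v u) s)))"
      by (simp add: sum_distrib_left mult_ac)
    finally show ?thesis by (simp only: mult.assoc)
  qed simp
  have "wz_slice p (\<lambda>x. \<Sum>u\<in>A. k u * v u x) \<le>
      (\<Sum>x\<in>UNIV. \<Sum>s\<in>UNIV. \<Sum>u\<in>A. k u * (pmf p (x, s) * v u x * ln (v u x / Q (v u) s)))"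
    using Q unfolding wz_slice_def by (intro sum_mono) (metis Q_def termwise)
  also have "\<dots> = (\<Sum>x\<in>UNIV. \<Sum>u\<in>A. \<Sum>s\<in>UNIV. k u * (pmf p (x, s) * v u x * ln (v u x / Q (v u) s)))"
    by (intro sum.cong refl sum.swap)
  also have "\<dots> = (\<Sum>u\<in>A. \<Sum>x\<in>UNIV. \<Sum>s\<in>UNIV. k u * (pmf p (x, s) * v u x * ln (v u x / Q (v u) s)))"
    by (rule sum.swap)
  finally show ?thesis
    by (simp add: wz_slice_def Q_def sum_distrib_left)
qed

text \<open>One half of the variational formula for a slice. For fixed \<open>s\<close> the log-sum
  inequality compares the weights p(x, s) v(x), of total A, with the weights A exp y(x, s), whose
  total is at most A.\<close>

lemma wz_slice_ge_linear:
  fixes p :: "('x::finite \<times> 's::finite) pmf"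
  assumes v: "\<And>x. 0 \<le> v x" and ps: "\<And>s. 0 < prob_s p s"
    and y: "\<And>s. (\<Sum>x\<in>UNIV. exp (y x s)) \<le> 1"
  shows "(\<Sum>x\<in>UNIV. v x * (\<Sum>s\<in>UNIV. pmf p (x, s) * (y x s - ln (prob_x_given_s p x s))))
    \<le> wz_slice p v"
proof -
  have main: "(\<Sum>x\<in>UNIV. pmf p (x, s) * v x * (y x s - ln (prob_x_given_s p x s)))
      \<le> (\<Sum>x\<in>UNIV. pmf p (x, s) * v x * ln (v x / ((\<Sum>x'\<in>UNIV. pmf p (x', s) * v x') / prob_s p s)))"
    for s
  proof -
    define a where "a x = pmf p (x, s) * v x" for x
    define A where "A = (\<Sum>x\<in>UNIV. a x)"
    have a: "0 \<le> a x" for x using v by (simp add: a_def)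
    have A: "0 \<le> A" unfolding A_def using a by (intro sum_nonneg) auto
    have a0: "a x = 0" if "A = 0" for x
      using joint_weight_eq_0[where v = v and p = p and s = s and x = x] v that by (simp add: A_def a_def)
    have "0 \<le> A * ln (A / (\<Sum>x\<in>UNIV. A * exp (y x s)))"
    proof (cases "A = 0")
      case False
      then have "0 < A" using A by simp
      moreover have "0 < (\<Sum>x\<in>UNIV. exp (y x s))" by (intro sum_pos) auto
      ultimately have "1 \<le> A / (\<Sum>x\<in>UNIV. A * exp (y x s))"
        using y[of s] by (simp add: sum_distrib_left[symmetric] field_simps)
      then show ?thesis using A by simp
    qed simp
    also have "\<dots> \<le> (\<Sum>x\<in>UNIV. a x * ln (a x / (A * exp (y x s))))"
      unfolding A_def using A a a0
      by (intro log_sum_inequality) (auto simp: A_def)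
    \<comment> \<open>The quotient a / (A exp y) factors as v / (A / p(s)) times p(x|s) exp (- y); a
      zero weight makes both sides 0.\<close>
    also have "\<dots> = (\<Sum>x\<in>UNIV. a x * ln (v x / (A / prob_s p s)) - a x * (y x s - ln (prob_x_given_s p x s)))"
    proof (intro sum.cong refl)
      fix x
      show "a x * ln (a x / (A * exp (y x s))) =
          a x * ln (v x / (A / prob_s p s)) - a x * (y x s - ln (prob_x_given_s p x s))"
      proof (cases "a x = 0")
        case False
        then have "0 < pmf p (x, s)" "0 < v x" "A \<noteq> 0"
          using v[of x] a0[of x] by (auto simp: a_def less_le)
        then show ?thesis
          using A ps[of s] by (simp add: a_def prob_x_given_s_def ln_div ln_mult algebra_simps)
      qed simp
    qed
    finally show ?thesis
      by (simp add: sum_subtractf a_def A_def)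
  qed
  have "(\<Sum>x\<in>UNIV. v x * (\<Sum>s\<in>UNIV. pmf p (x, s) * (y x s - ln (prob_x_given_s p x s))))
    = (\<Sum>s\<in>UNIV. \<Sum>x\<in>UNIV. pmf p (x, s) * v x * (y x s - ln (prob_x_given_s p x s)))"
    by (subst sum.swap) (simp add: sum_distrib_left mult_ac)
  also have "\<dots> \<le> (\<Sum>s\<in>UNIV. \<Sum>x\<in>UNIV. pmf p (x, s) * v x *
      ln (v x / ((\<Sum>x'\<in>UNIV. pmf p (x', s) * v x') / prob_s p s)))"
    by (intro sum_mono main)
  also have "\<dots> = wz_slice p v"
    unfolding wz_slice_def by (rule sum.swap)
  finally show ?thesis .
qed


section \<open>The geometric program in convex form\<close>

lemma inner_exp_vec: "b \<in> Basis \<Longrightarrow> exp_vec z \<bullet> b = exp (z \<bullet> b)"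
  by (simp add: exp_vec_def inner_sum_left inner_Basis if_distrib sum.delta cong: if_cong)

text \<open>The exponent vector is the gradient of \<open>L\<close>, obtained by applying the
  adjoint to 1; the constant \<beta> becomes the coefficient exp \<beta>.\<close>

lemma monomial_exp_linear:
  fixes L :: "'v::euclidean_space \<Rightarrow> real"
  assumes "linear L"
  obtains m where "monomial m" "\<And>z. m (exp_vec z) = exp (L z + \<beta>)"
proof
  define a where "a = adjoint L 1"
  define m where "m v = exp \<beta> * (\<Prod>b\<in>Basis. (v \<bullet> b) powr (a \<bullet> b))" for v
  show "monomial m"
    unfolding monomial_def m_def by (intro exI[of _ "exp \<beta>"] conjI exI[of _ a]) auto
  fix z
  have "L z = a \<bullet> z"
    using adjoint_works[OF assms, of z 1] by (simp add: a_def inner_commute)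
  also have "\<dots> = (\<Sum>b\<in>Basis. (a \<bullet> b) * (z \<bullet> b))"
    by (rule euclidean_inner)
  finally have "exp (L z + \<beta>) = exp \<beta> * (\<Prod>b\<in>Basis. exp ((a \<bullet> b) * (z \<bullet> b)))"
    by (simp add: exp_add exp_sum)
  then show "m (exp_vec z) = exp (L z + \<beta>)"
    by (simp add: m_def inner_exp_vec powr_def)
qed

lemma posynomial_sum:
  assumes "finite I" "I \<noteq> {}" "\<And>i. i \<in> I \<Longrightarrow> monomial (m i)"
  shows "posynomial (\<lambda>v. \<Sum>i\<in>I. m i v)"
proof -
  obtain h where h: "bij_betw h {0..<card I} I"
    using ex_bij_betw_nat_finite[OF assms(1)] by blast
  have "(\<Sum>i\<in>I. m i v) = (\<Sum>k<card I. m (h k) v)" for v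
    using sum.reindex_bij_betw[OF h, of "\<lambda>i. m i v"] by (simp add: atLeast0LessThan)
  moreover have "monomial (m (h k))" if "k < card I" for k
    using bij_betwE[OF h] that assms(3) by simp
  ultimately show ?thesis
    unfolding posynomial_def using assms(1,2)
    by (intro exI[of _ "card I"] conjI exI[of _ "\<lambda>k. m (h k)"]) (auto simp: card_gt_0_iff)
qed

text \<open>Each exponential becomes a monomial. A one-element index set covers affine functions,
  where ln undoes exp.\<close>

lemma posynomial_log_sum_exp_linear:
  fixes L :: "'i \<Rightarrow> 'v::euclidean_space \<Rightarrow> real"
  assumes "finite I" "I \<noteq> {}" "\<And>i. i \<in> I \<Longrightarrow> linear (L i)"
  shows "\<exists>f. posynomial f \<and> (\<forall>z. ln (\<Sum>i\<in>I. exp (L i z + \<beta> i)) = ln (f (exp_vec z)))"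
proof -
  have "\<exists>m. monomial m \<and> (\<forall>z. m (exp_vec z) = exp (L i z + \<beta> i))" if "i \<in> I" for i
    using monomial_exp_linear[OF assms(3)[OF that], of "\<beta> i"] by metis
  then obtain m where m: "\<And>i. i \<in> I \<Longrightarrow> monomial (m i)"
    "\<And>i z. i \<in> I \<Longrightarrow> m i (exp_vec z) = exp (L i z + \<beta> i)"
    by metis
  show ?thesis
    using posynomial_sum[OF assms(1,2) m(1)] m(2)
    by (intro exI[of _ "\<lambda>v. \<Sum>i\<in>I. m i v"]) simp
qed

lemma posynomial_log_affine:
  fixes L :: "'v::euclidean_space \<Rightarrow> real"
  assumes "linear L" "\<And>z. g z = L z + \<beta>"
  shows "\<exists>f. posynomial f \<and> (\<forall>z. g z = ln (f (exp_vec z)))"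
  using posynomial_log_sum_exp_linear[of "{()}" "\<lambda>_. L" "\<lambda>_. \<beta>"] assms by simp

lemma finite_gp_ineq: "finite (UNIV :: ('x::finite, 's::finite, 't::finite) gp_ineq set)"
proof -
  have "(UNIV :: ('x, 's, 't) gp_ineq set) =
      insert GammaNonneg (range (\<lambda>(x, t). Alpha x t) \<union> range (\<lambda>(s, t). LogSumExp s t))"
  proof (intro set_eqI iffI UNIV_I)
    fix i :: "('x, 's, 't) gp_ineq"
    show "i \<in> insert GammaNonneg (range (\<lambda>(x, t). Alpha x t) \<union> range (\<lambda>(s, t). LogSumExp s t))"
      by (cases i) (auto intro: image_eqI[of _ _ "(_, _)"])
  qed
  then show ?thesis by (metis finite finite_Un finite_imageI finite_insert)
qed

lemma gp_convex_form_wz_gp: "gp_convex_form (wz_gp p d D)"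
  for d :: "'x::finite \<Rightarrow> 'r::finite \<Rightarrow> real" and p :: "('x \<times> 's::finite) pmf"
proof -
  have obj: "\<exists>f. posynomial f \<and> (\<forall>z. objective (wz_gp p d D) z = ln (f (exp_vec z)))"
    by (rule posynomial_log_affine[where \<beta> = 0 and L = "objective (wz_gp p d D)"])
      (auto intro!: linearI simp: wz_gp_def wz_gp_objective_def sum.distrib algebra_simps sum_distrib_left)
  have ineq: "\<exists>f. posynomial f \<and> (\<forall>z. ineq (wz_gp p d D) i z = ln (f (exp_vec z)))" for i
  proof (cases i)
    case (Alpha x t)
    \<comment> \<open>The logarithms of p(x|s) are constants and form the offset; the rest of the
      constraint is linear in the variables.\<close>
    define \<beta> where "\<beta> = (\<Sum>s\<in>UNIV. prob_s_given_x p s x * ln (prob_x_given_s p x s))"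
    define L where "L = (\<lambda>(\<alpha> :: real^'x, \<gamma>, y :: real^('s \<Rightarrow> 'r)^'s^'x). \<alpha> $ x -
      (\<Sum>s\<in>UNIV. prob_s_given_x p s x * (\<gamma> * d x (t s) + y $ x $ s $ t)))"
    show ?thesis
    proof (rule posynomial_log_affine[where \<beta> = \<beta> and L = L])
      show "linear L"
        by (intro linearI) (auto simp: L_def sum.distrib algebra_simps sum_distrib_left)
      show "ineq (wz_gp p d D) i z = L z + \<beta>" for z
        by (auto simp: Alpha wz_gp_def L_def \<beta>_def sum.distrib sum_subtractf algebra_simps
            split: prod.splits)
    qed
  next
    case (LogSumExp s t)
    have "linear (\<lambda>(\<alpha> :: real^'x, \<gamma> :: real, y :: real^('s \<Rightarrow> 'r)^'s^'x). y $ x $ s $ t)" for x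
      by (intro linearI) auto
    then show ?thesis
      using posynomial_log_sum_exp_linear[of "UNIV :: 'x set"
          "\<lambda>x (\<alpha> :: real^'x, \<gamma> :: real, y :: real^('s \<Rightarrow> 'r)^'s^'x). y $ x $ s $ t" "\<lambda>_. 0"]
      by (auto simp: LogSumExp wz_gp_def case_prod_beta')
  next
    case GammaNonneg
    show ?thesis
      by (rule posynomial_log_affine[where \<beta> = 0 and L = "ineq (wz_gp p d D) i"])
        (auto intro!: linearI simp: GammaNonneg wz_gp_def)
  qed
  show ?thesis
    unfolding gp_convex_form_def using obj ineq finite_gp_ineq by (auto simp: wz_gp_def)
qed


section \<open>The Lagrange dual\<close>

lemma sum_wz_ineq:
  fixes f :: "('x::finite, 't::finite) wz_ineq \<Rightarrow> real"
  shows "(\<Sum>i\<in>UNIV. f i) = f Distortion + (\<Sum>x\<in>UNIV. \<Sum>t\<in>UNIV. f (Nonneg x t))"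
proof -
  have "(UNIV :: ('x, 't) wz_ineq set) = insert Distortion (range (\<lambda>(x, t). Nonneg x t))"
  proof (intro set_eqI iffI UNIV_I)
    fix i :: "('x, 't) wz_ineq"
    show "i \<in> insert Distortion (range (\<lambda>(x, t). Nonneg x t))"
      by (cases i) (auto intro: image_eqI[of _ _ "(_, _)"])
  qed
  then have "(\<Sum>i\<in>UNIV. f i) = (\<Sum>i\<in>insert Distortion (range (\<lambda>(x, t). Nonneg x t)). f i)"
    by simp
  also have "\<dots> = f Distortion + (\<Sum>i\<in>range (\<lambda>(x, t). Nonneg x t). f i)"
    by (rule sum.insert) auto
  also have "(\<Sum>i\<in>range (\<lambda>(x, t). Nonneg x t). f i) = (\<Sum>(x, t)\<in>UNIV. f (Nonneg x t))"
    by (subst sum.reindex) (auto simp: inj_on_def o_def case_prod_beta')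
  also have "\<dots> = (\<Sum>x\<in>UNIV. \<Sum>t\<in>UNIV. f (Nonneg x t))"
    by (simp add: sum.cartesian_product)
  finally show ?thesis .
qed

text \<open>The coefficient of q(t|x) in the Lagrangian apart from the rate term, a reduced
  cost.\<close>

definition wz_price ::
    "('x::finite \<times> 's::finite) pmf \<Rightarrow> ('x \<Rightarrow> 'r::finite \<Rightarrow> real) \<Rightarrow>
      (('x, 's \<Rightarrow> 'r) wz_ineq \<Rightarrow> real) \<Rightarrow> ('x \<Rightarrow> real) \<Rightarrow> ('s \<Rightarrow> 'r) \<Rightarrow> 'x \<Rightarrow> real" where
  "wz_price p d lam mu t x =
     lam Distortion * (\<Sum>s\<in>UNIV. pmf p (x, s) * d x (t s)) - lam (Nonneg x t) + mu x"

lemma lagrangian_wz_problem: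
  fixes p :: "('x::finite \<times> 's::finite) pmf" and d :: "'x \<Rightarrow> 'r::finite \<Rightarrow> real"
  shows "lagrangian (wz_problem p d D) q lam mu =
     (\<Sum>t\<in>UNIV. wz_slice p (\<lambda>x. q $ x $ t) + (\<Sum>x\<in>UNIV. wz_price p d lam mu t x * q $ x $ t))
       - lam Distortion * D - (\<Sum>x\<in>UNIV. mu x)"
proof -
  have "lagrangian (wz_problem p d D) q lam mu =
    (\<Sum>t\<in>UNIV. wz_slice p (\<lambda>x. q $ x $ t)) +
    lam Distortion * ((\<Sum>t\<in>UNIV. \<Sum>x\<in>UNIV. (\<Sum>s\<in>UNIV. pmf p (x, s) * d x (t s)) * q $ x $ t) - D) -
    (\<Sum>x\<in>UNIV. \<Sum>t\<in>UNIV. lam (Nonneg x t) * q $ x $ t) +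
    (\<Sum>x\<in>UNIV. mu x * ((\<Sum>t\<in>UNIV. q $ x $ t) - 1))"
    by (simp add: lagrangian_def wz_problem_def wz_objective_eq_slices wz_distortion_eq_slices
        sum_wz_ineq sum_negf)
  also have "(\<Sum>x\<in>UNIV. \<Sum>t\<in>UNIV. lam (Nonneg x t) * q $ x $ t) =
      (\<Sum>t\<in>UNIV. \<Sum>x\<in>UNIV. lam (Nonneg x t) * q $ x $ t)"
    by (rule sum.swap)
  also have "(\<Sum>x\<in>UNIV. mu x * ((\<Sum>t\<in>UNIV. q $ x $ t) - 1)) =
      (\<Sum>x\<in>UNIV. \<Sum>t\<in>UNIV. mu x * q $ x $ t) - (\<Sum>x\<in>UNIV. mu x)"
    by (simp add: right_diff_distrib sum_subtractf sum_distrib_left)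
  also have "(\<Sum>x\<in>UNIV. \<Sum>t\<in>UNIV. mu x * q $ x $ t) = (\<Sum>t\<in>UNIV. \<Sum>x\<in>UNIV. mu x * q $ x $ t)"
    by (rule sum.swap)
  finally show ?thesis
    by (simp add: wz_price_def sum.distrib sum_subtractf sum_distrib_left algebra_simps)
qed

lemma domain_wz_problem: "domain (wz_problem p d D) = {q. \<forall>x t. 0 \<le> q $ x $ t}"
  by (simp add: wz_problem_def)

text \<open>The infimum is attained at q = 0, which lies in the domain because the row sums are
  relaxed into the Lagrangian.\<close>

lemma dual_function_wz_problem_eq:
  fixes p :: "('x::finite \<times> 's::finite) pmf" and d :: "'x \<Rightarrow> 'r::finite \<Rightarrow> real"
  assumes "\<And>t v. (\<And>x. 0 \<le> v x) \<Longrightarrow> 0 \<le> wz_slice p v + (\<Sum>x\<in>UNIV. wz_price p d lam mu t x * v x)"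
  shows "dual_function (wz_problem p d D) lam mu = ereal (- lam Distortion * D - (\<Sum>x\<in>UNIV. mu x))"
  unfolding dual_function_def
proof (rule antisym)
  show "(INF v\<in>domain (wz_problem p d D). ereal (lagrangian (wz_problem p d D) v lam mu))
      \<le> ereal (- lam Distortion * D - (\<Sum>x\<in>UNIV. mu x))"
    by (rule INF_lower2[of 0])
      (simp_all add: domain_wz_problem lagrangian_wz_problem wz_slice_zero)
  show "ereal (- lam Distortion * D - (\<Sum>x\<in>UNIV. mu x))
      \<le> (INF v\<in>domain (wz_problem p d D). ereal (lagrangian (wz_problem p d D) v lam mu))"
  proof (rule INF_greatest)
    fix q assume "q \<in> domain (wz_problem p d D)"
    then have "0 \<le> (\<Sum>t\<in>UNIV. wz_slice p (\<lambda>x. q $ x $ t) +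
        (\<Sum>x\<in>UNIV. wz_price p d lam mu t x * q $ x $ t))"
      by (intro sum_nonneg assms) (simp add: domain_wz_problem)
    then show "ereal (- lam Distortion * D - (\<Sum>x\<in>UNIV. mu x))
        \<le> ereal (lagrangian (wz_problem p d D) q lam mu)"
      by (simp add: lagrangian_wz_problem)
  qed
qed

text \<open>A direction with negative value could be scaled without limit inside the orthant and
  would drive the Lagrangian to -\<infinity>.\<close>

lemma wz_slice_nonneg_of_dual_function:
  fixes p :: "('x::finite \<times> 's::finite) pmf" and d :: "'x \<Rightarrow> 'r::finite \<Rightarrow> real"
  assumes fin: "dual_function (wz_problem p d D) lam mu \<noteq> - \<infinity>" and v: "\<And>x. 0 \<le> v x"
  shows "0 \<le> wz_slice p v + (\<Sum>x\<in>UNIV. wz_price p d lam mu t x * v x)"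
proof (rule ccontr)
  define h where "h = wz_slice p v + (\<Sum>x\<in>UNIV. wz_price p d lam mu t x * v x)"
  define k where "k = - lam Distortion * D - (\<Sum>x\<in>UNIV. mu x)"
  assume "\<not> 0 \<le> wz_slice p v + (\<Sum>x\<in>UNIV. wz_price p d lam mu t x * v x)"
  then have h: "h < 0" by (simp add: h_def)
  have "dual_function (wz_problem p d D) lam mu \<le> ereal B" for B
  proof -
    \<comment> \<open>As \<open>h\<close> is negative, any factor at least (B - k) / h brings c h
      down to B - k; the maximum with 1 keeps the factor positive.\<close>
    define c where "c = max 1 ((B - k) / h)"
    have c: "0 < c" by (simp add: c_def)
    have "c * h \<le> B - k"
      using h by (simp add: c_def neg_divide_le_eq[symmetric])
    \<comment> \<open>Only the column of the map \<open>t\<close> is nonzero, so the other slices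
      contribute nothing.\<close>
    define q :: "real^('s \<Rightarrow> 'r)^'x" where "q = (\<chi> x t'. if t' = t then c * v x else 0)"
    have "wz_slice p (\<lambda>x. q $ x $ t') + (\<Sum>x\<in>UNIV. wz_price p d lam mu t' x * q $ x $ t') =
        (if t' = t then c * h else 0)" for t'
      using c by (simp add: q_def h_def wz_slice_zero wz_slice_scale sum_distrib_left algebra_simps)
    then have "lagrangian (wz_problem p d D) q lam mu = c * h + k"
      by (simp add: lagrangian_wz_problem k_def)
    moreover have "q \<in> domain (wz_problem p d D)"
      using v c by (simp add: domain_wz_problem q_def)
    ultimately show ?thesis
      unfolding dual_function_def using \<open>c * h \<le> B - k\<close> by (intro INF_lower2[of q]) auto
  qed
  then show False using fin by (meson ereal_bot)
qed

section \<open>Exchange of infimum and supremum for one map\<close>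

text \<open>
  Separating 0 from the convex set of achievable right-hand sides yields a vector \<open>q \<ge> 0\<close>.  The
  optimal \<open>y\<close> for \<open>q\<close> is the logarithm of a posterior, which may vanish; it is mixed with the
  uniform distribution, at a cost that \<open>\<epsilon>\<close> pays for.
\<close>

lemma wz_slice_minorant:
  fixes p :: "('x::finite \<times> 's::finite) pmf" and c :: "'x \<Rightarrow> real"
  assumes px: "\<And>x. 0 < prob_x p x" and ps: "\<And>s. 0 < prob_s p s"
    and nn: "\<And>v. (\<And>x. 0 \<le> v x) \<Longrightarrow> 0 \<le> wz_slice p v + (\<Sum>x\<in>UNIV. c x * v x)"
    and \<epsilon>: "0 < \<epsilon>"
  obtains y where "\<And>s. (\<Sum>x\<in>UNIV. exp (y x s)) \<le> 1"
    and "\<And>x. 0 \<le> c x + \<epsilon> * prob_x p x +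
          (\<Sum>s\<in>UNIV. pmf p (x, s) * (y x s - ln (prob_x_given_s p x s)))"
proof -
  define F where "F y x = c x + \<epsilon> * prob_x p x +
      (\<Sum>s\<in>UNIV. pmf p (x, s) * (y x s - ln (prob_x_given_s p x s)))" for y :: "'x \<Rightarrow> 's \<Rightarrow> real" and x
  define Y where "Y = {y :: 'x \<Rightarrow> 's \<Rightarrow> real. \<forall>s. (\<Sum>x\<in>UNIV. exp (y x s)) \<le> 1}"
  \<comment> \<open>\<open>K\<close> is closed under lowering coordinates, so 0 \<in> K says
    precisely that some y \<in> Y satisfies all the inequalities.\<close>
  define K where "K = {z :: real^'x. \<exists>y\<in>Y. \<forall>x. z $ x \<le> F y x}"
  have "convex K"
  proof (rule convexI)
    fix z1 z2 :: "real^'x" and a b :: real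
    assume z: "z1 \<in> K" "z2 \<in> K" and ab: "0 \<le> a" "0 \<le> b" "a + b = 1"
    obtain y1 y2 where y: "y1 \<in> Y" "y2 \<in> Y" "\<And>x. z1 $ x \<le> F y1 x" "\<And>x. z2 $ x \<le> F y2 x"
      using z by (auto simp: K_def)
    define y where "y = (\<lambda>x s. a * y1 x s + b * y2 x s)"
    have Feq: "F y x = a * F y1 x + b * F y2 x" for x
    proof -
      have "a * F y1 x + b * F y2 x = (a + b) * (c x + \<epsilon> * prob_x p x) +
        (\<Sum>s\<in>UNIV. pmf p (x, s) * (y x s - (a + b) * ln (prob_x_given_s p x s)))"
        by (simp add: F_def y_def sum_distrib_left sum.distrib[symmetric] algebra_simps)
      then show ?thesis using ab by (simp add: F_def)
    qed
    have "(\<Sum>x\<in>UNIV. exp (y x s)) \<le> 1" for s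
    proof -
      have "exp (y x s) \<le> a * exp (y1 x s) + b * exp (y2 x s)" for x
      proof -
        have "a = 1 - b" using ab by simp
        then show ?thesis
          using convex_onD[OF exp_convex, of b "y1 x s" "y2 x s"] ab(1,2) by (simp add: y_def)
      qed
      then have "(\<Sum>x\<in>UNIV. exp (y x s)) \<le> (\<Sum>x\<in>UNIV. a * exp (y1 x s) + b * exp (y2 x s))"
        by (intro sum_mono)
      also have "\<dots> = a * (\<Sum>x\<in>UNIV. exp (y1 x s)) + b * (\<Sum>x\<in>UNIV. exp (y2 x s))"
        by (simp add: sum.distrib sum_distrib_left)
      also have "\<dots> \<le> a * 1 + b * 1"
        using y(1,2) ab by (intro add_mono mult_left_mono) (auto simp: Y_def)
      finally show ?thesis using ab by simp
    qed
    then have "y \<in> Y" by (simp add: Y_def)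
    moreover have "(a *\<^sub>R z1 + b *\<^sub>R z2) $ x \<le> F y x" for x
      using y(3,4) ab unfolding Feq by (auto intro!: add_mono mult_left_mono)
    ultimately show "a *\<^sub>R z1 + b *\<^sub>R z2 \<in> K" by (auto simp: K_def)
  qed
  have "0 \<in> K"
  proof (rule ccontr)
    assume "0 \<notin> K"
    then obtain a where a: "a \<noteq> 0" "\<And>z. z \<in> K \<Longrightarrow> 0 \<le> a \<bullet> z"
      using separating_hyperplane_set_0[OF \<open>convex K\<close>] by blast
    \<comment> \<open>The flipped normal gives a functional that is nonpositive on \<open>K\<close>;
      this \<open>q\<close> will contradict \<open>nn\<close>.\<close>
    define q where "q x = - a $ x" for x
    have qK: "(\<Sum>x\<in>UNIV. q x * z $ x) \<le> 0" if "z \<in> K" for z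
      using a(2)[OF that] by (simp add: q_def inner_vec_def sum_negf)
    have qF: "(\<Sum>x\<in>UNIV. q x * F y x) \<le> 0" if "y \<in> Y" for y
      using qK[of "\<chi> x. F y x"] that by (auto simp: K_def)
    define n where "n = real CARD('x)"
    have n: "0 < n" by (simp add: n_def)
    \<comment> \<open>This choice makes ln (1 - \<delta>) = - \<epsilon> / 2: mixing costs half of
      the allowance, and the other half remains for the contradiction.\<close>
    define \<delta> where "\<delta> = 1 - exp (- \<epsilon> / 2)"
    have \<delta>: "0 < \<delta>" "1 - \<delta> = exp (- \<epsilon> / 2)" using \<epsilon> by (auto simp: \<delta>_def)
    have q: "0 \<le> q x0" for x0
    proof (rule ccontr)
      assume "\<not> 0 \<le> q x0"
      \<comment> \<open>The uniform choice is a point of \<open>Y\<close>. Lowering coordinate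
        \<open>x0\<close> by \<open>m\<close> stays in \<open>K\<close>, yet for negative
        \<open>q x0\<close> it would lift the functional to A + |A| + 1 > 0.\<close>
      define y :: "'x \<Rightarrow> 's \<Rightarrow> real" where "y = (\<lambda>x s. ln (1 / n))"
      have y: "y \<in> Y" using n by (simp add: Y_def y_def exp_minus ln_div n_def)
      define A where "A = (\<Sum>x\<in>UNIV. q x * F y x)"
      define m where "m = (\<bar>A\<bar> + 1) / - q x0"
      have m: "0 \<le> m" using \<open>\<not> 0 \<le> q x0\<close> unfolding m_def by (intro divide_nonneg_pos) auto
      have "(\<chi> x. F y x - (if x = x0 then m else 0)) \<in> K"
        using y m by (auto simp: K_def intro!: bexI[of _ y])
      from qK[OF this] have "(\<Sum>x\<in>UNIV. q x * (F y x - (if x = x0 then m else 0))) \<le> 0"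
        by simp
      moreover have "(\<Sum>x\<in>UNIV. q x * (F y x - (if x = x0 then m else 0))) =
          (\<Sum>x\<in>UNIV. q x * F y x - (if x = x0 then q x0 * m else 0))"
        by (intro sum.cong) (auto simp: algebra_simps)
      ultimately have "A - q x0 * m \<le> 0"
        by (simp add: A_def sum_subtractf)
      moreover have "q x0 * m = - (\<bar>A\<bar> + 1)"
        using \<open>\<not> 0 \<le> q x0\<close> by (simp add: m_def field_simps)
      ultimately show False by simp
    qed
    define Q where "Q s = (\<Sum>x\<in>UNIV. pmf p (x, s) * q x)" for s
    have Q: "0 \<le> Q s" for s unfolding Q_def using q by (intro sum_nonneg) auto
    \<comment> \<open>The posterior of x given s under \<open>q\<close>. If \<open>Q s\<close> is 0
      the division yields 0, so the total mass is only bounded by 1.\<close>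
    define r where "r x s = pmf p (x, s) * q x / Q s" for x s
    have r: "0 \<le> r x s" for x s using q Q by (simp add: r_def)
    have rsum: "(\<Sum>x\<in>UNIV. r x s) \<le> 1" for s
      by (cases "Q s = 0") (simp_all add: r_def Q_def sum_divide_distrib[symmetric])
    define y where "y x s = ln ((1 - \<delta>) * r x s + \<delta> / n)" for x s
    have pos: "0 < (1 - \<delta>) * r x s + \<delta> / n" for x s
      using \<delta> n r by (intro add_nonneg_pos) (auto simp: \<delta>(2))
    have "y \<in> Y"
    proof -
      have "(\<Sum>x\<in>UNIV. exp (y x s)) = (1 - \<delta>) * (\<Sum>x\<in>UNIV. r x s) + \<delta>" for s
        using pos n by (simp add: y_def sum.distrib sum_distrib_left n_def)
      also have "\<dots> s \<le> (1 - \<delta>) * 1 + \<delta>" for s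
        using rsum by (intro add_mono mult_left_mono) (auto simp: \<delta>(2))
      finally show ?thesis by (simp add: Y_def)
    qed
    have termwise: "pmf p (x, s) * q x * (ln (q x / (Q s / prob_s p s)) - \<epsilon> / 2)
        \<le> pmf p (x, s) * q x * (y x s - ln (prob_x_given_s p x s))" for x s
    proof (cases "pmf p (x, s) * q x = 0")
      case False
      then have P: "0 < pmf p (x, s)" "0 < q x" using q[of x] by (auto simp: less_le)
      have "Q s \<noteq> 0"
        using joint_weight_eq_0[where v = q and p = p and s = s and x = x] q False
        by (auto simp: Q_def)
      then have Q': "0 < Q s" using Q[of s] by simp
      have r': "0 < r x s" using P Q' by (simp add: r_def)
      \<comment> \<open>Discarding the uniform share leaves the posterior times 1 - \<delta>, whose
        logarithm is short by \<epsilon> / 2.\<close>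
      have "ln ((1 - \<delta>) * r x s) \<le> y x s"
        unfolding y_def using r' \<delta> n by (subst ln_le_cancel_iff) (auto intro: add_pos_pos)
      also have "ln ((1 - \<delta>) * r x s) = - \<epsilon> / 2 + ln (r x s)"
        using r' by (simp add: \<delta>(2) ln_mult)
      also have "ln (r x s) = ln (q x / (Q s / prob_s p s)) + ln (prob_x_given_s p x s)"
        using P Q' ps[of s] by (simp add: r_def prob_x_given_s_def ln_div ln_mult)
      finally show ?thesis using P by (intro mult_left_mono) auto
    qed auto
    have px_sum: "(\<Sum>x\<in>UNIV. q x * prob_x p x) = (\<Sum>x\<in>UNIV. \<Sum>s\<in>UNIV. pmf p (x, s) * q x)"
      by (simp add: prob_x_eq_sum sum_distrib_left mult_ac)
    obtain x0 where "q x0 \<noteq> 0"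
      using a(1) by (auto simp: q_def vec_eq_iff)
    \<comment> \<open>Strictness comes from here: \<open>q\<close> is nonnegative and not 0, and all
      marginals of x are positive.\<close>
    then have qpos: "0 < (\<Sum>x\<in>UNIV. q x * prob_x p x)"
      using q px by (intro sum_pos2[of _ x0]) (auto simp: less_le)
    have "wz_slice p q - \<epsilon> / 2 * (\<Sum>x\<in>UNIV. q x * prob_x p x) =
        (\<Sum>x\<in>UNIV. \<Sum>s\<in>UNIV. pmf p (x, s) * q x * (ln (q x / (Q s / prob_s p s)) - \<epsilon> / 2))"
      unfolding px_sum
      by (simp add: wz_slice_def Q_def right_diff_distrib sum_subtractf sum_distrib_left mult_ac)
    also have "\<dots> \<le> (\<Sum>x\<in>UNIV. \<Sum>s\<in>UNIV. pmf p (x, s) * q x * (y x s - ln (prob_x_given_s p x s)))"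
      by (intro sum_mono termwise)
    also have "\<dots> = (\<Sum>x\<in>UNIV. q x * F y x) - (\<Sum>x\<in>UNIV. c x * q x) - \<epsilon> * (\<Sum>x\<in>UNIV. q x * prob_x p x)"
      by (simp add: F_def algebra_simps sum.distrib sum_distrib_left sum_subtractf)
    finally have "wz_slice p q + (\<Sum>x\<in>UNIV. c x * q x) + \<epsilon> / 2 * (\<Sum>x\<in>UNIV. q x * prob_x p x) \<le> 0"
      using qF[OF \<open>y \<in> Y\<close>] by simp
    moreover have "0 < \<epsilon> / 2 * (\<Sum>x\<in>UNIV. q x * prob_x p x)"
      using qpos \<epsilon> by simp
    ultimately show False using nn[of q] q by simp
  qed
  then show ?thesis using that by (auto simp: K_def Y_def F_def)
qed

section \<open>Multipliers and points of the geometric program\<close>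

lemma prob_s_given_x_eq:
  "0 < prob_x p x \<Longrightarrow> prob_x p x * (\<Sum>s\<in>UNIV. prob_s_given_x p s x * f s) = (\<Sum>s\<in>UNIV. pmf p (x, s) * f s)"
  by (simp add: prob_s_given_x_def sum_distrib_left)

lemma sum_exp_le_1_iff: "ln (\<Sum>x\<in>UNIV. exp (y x)) \<le> 0 \<longleftrightarrow> (\<Sum>x\<in>UNIV. exp (y x)) \<le> (1::real)"
  for y :: "'x::finite \<Rightarrow> real"
proof -
  have "0 < (\<Sum>x\<in>UNIV. exp (y x))" by (intro sum_pos) auto
  then show ?thesis by simp
qed

lemma feasible_wz_gp_iff:
  fixes p :: "('x::finite \<times> 's::finite) pmf" and d :: "'x \<Rightarrow> 'r::finite \<Rightarrow> real"
  shows "(\<alpha>, \<gamma>, y) \<in> feasible (wz_gp p d D) \<longleftrightarrow>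
     (\<forall>x t. \<alpha> $ x + (\<Sum>s\<in>UNIV. prob_s_given_x p s x *
        (ln (prob_x_given_s p x s) - \<gamma> * d x (t s) - y $ x $ s $ t)) \<le> 0) \<and>
     (\<forall>s t. (\<Sum>x\<in>UNIV. exp (y $ x $ s $ t)) \<le> 1) \<and> 0 \<le> \<gamma>"
proof -
  have *: "(\<forall>i. R i) \<longleftrightarrow> (\<forall>x t. R (Alpha x t)) \<and> (\<forall>s t. R (LogSumExp s t)) \<and> R GammaNonneg"
    for R :: "('x, 's, 's \<Rightarrow> 'r) gp_ineq \<Rightarrow> bool"
    by (metis gp_ineq.exhaust)
  show ?thesis
    by (simp add: feasible_def wz_gp_def * sum_exp_le_1_iff)
qed

context
  fixes p :: "('x::finite \<times> 's::finite) pmf" and d :: "'x \<Rightarrow> 'r::finite \<Rightarrow> real" and D :: real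
  assumes px: "\<And>x. 0 < prob_x p x" and ps: "\<And>s. 0 < prob_s p s"
begin

text \<open>Multiplied by p(x), the \<open>Alpha\<close> constraint says that the reduced cost plus
  the coefficient of the linear functional given by \<open>y\<close> is nonnegative. That functional
  lies below the slice, so every summand of the Lagrangian is nonnegative.\<close>

lemma dual_of_gp_feasible:
  fixes \<alpha> :: "real^'x" and \<gamma> :: real and y :: "real^('s \<Rightarrow> 'r)^'s^'x"
  assumes feas: "(\<alpha>, \<gamma>, y) \<in> feasible (wz_gp p d D)"
  defines "lam \<equiv> case_wz_ineq \<gamma> (\<lambda>_ _. 0)" and "mu \<equiv> \<lambda>x. - prob_x p x * \<alpha> $ x"
  shows "(lam, mu) \<in> dual_feasible (wz_problem p d D)"
    and "dual_function (wz_problem p d D) lam mu = ereal (wz_gp_objective p D (\<alpha>, \<gamma>, y))"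
proof -
  have \<gamma>: "0 \<le> \<gamma>" and lse: "\<And>s t. (\<Sum>x\<in>UNIV. exp (y $ x $ s $ t)) \<le> 1"
    and al: "\<And>x t. \<alpha> $ x + (\<Sum>s\<in>UNIV. prob_s_given_x p s x *
        (ln (prob_x_given_s p x s) - \<gamma> * d x (t s) - y $ x $ s $ t)) \<le> 0"
    using feas by (auto simp: feasible_wz_gp_iff)
  show "(lam, mu) \<in> dual_feasible (wz_problem p d D)"
    using \<gamma> by (auto simp: dual_feasible_def lam_def split: wz_ineq.split)
  have price: "0 \<le> wz_price p d lam mu t x +
      (\<Sum>s\<in>UNIV. pmf p (x, s) * (y $ x $ s $ t - ln (prob_x_given_s p x s)))" for t x
  proof -
    have "prob_x p x * (\<alpha> $ x + (\<Sum>s\<in>UNIV. prob_s_given_x p s x *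
        (ln (prob_x_given_s p x s) - \<gamma> * d x (t s) - y $ x $ s $ t))) \<le> 0"
      using al[of x t] px[of x] by (simp add: mult_nonneg_nonpos)
    then have "prob_x p x * \<alpha> $ x + (\<Sum>s\<in>UNIV. pmf p (x, s) *
        (ln (prob_x_given_s p x s) - \<gamma> * d x (t s) - y $ x $ s $ t)) \<le> 0"
      using prob_s_given_x_eq[OF px] by (simp add: distrib_left)
    then show ?thesis
      by (simp add: wz_price_def lam_def mu_def sum_subtractf sum.distrib sum_distrib_left algebra_simps)
  qed
  have "0 \<le> wz_slice p v + (\<Sum>x\<in>UNIV. wz_price p d lam mu t x * v x)"
    if v: "\<And>x. 0 \<le> v x" for t v
  proof -
    have "- (\<Sum>x\<in>UNIV. wz_price p d lam mu t x * v x) \<le>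
        (\<Sum>x\<in>UNIV. v x * (\<Sum>s\<in>UNIV. pmf p (x, s) * (y $ x $ s $ t - ln (prob_x_given_s p x s))))"
      unfolding sum_negf[symmetric]
    proof (rule sum_mono)
      fix x
      show "- (wz_price p d lam mu t x * v x) \<le>
          v x * (\<Sum>s\<in>UNIV. pmf p (x, s) * (y $ x $ s $ t - ln (prob_x_given_s p x s)))"
        using mult_left_mono[OF price[of t x] v[of x]] by (simp add: distrib_left mult.commute)
    qed
    also have "\<dots> \<le> wz_slice p v"
      using v ps lse by (intro wz_slice_ge_linear) auto
    finally show ?thesis by simp
  qed
  then have "dual_function (wz_problem p d D) lam mu = ereal (- lam Distortion * D - (\<Sum>x\<in>UNIV. mu x))"
    by (rule dual_function_wz_problem_eq)
  then show "dual_function (wz_problem p d D) lam mu = ereal (wz_gp_objective p D (\<alpha>, \<gamma>, y))"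
    by (simp add: lam_def mu_def wz_gp_objective_def sum_negf)
qed

text \<open>Finiteness makes each slice plus its reduced costs nonnegative, and
  \<open>wz_slice_minorant\<close> then supplies one \<open>y\<close> per map. The objective does
  not involve \<open>y\<close>, hence the first claim for all of them.\<close>

lemma gp_feasible_of_dual:
  assumes feas: "(lam, mu) \<in> dual_feasible (wz_problem p d D)"
    and fin: "dual_function (wz_problem p d D) lam mu \<noteq> - \<infinity>"
  defines "\<alpha> \<equiv> (\<chi> x. - mu x / prob_x p x)" and "\<gamma> \<equiv> lam Distortion"
  shows "dual_function (wz_problem p d D) lam mu = ereal (wz_gp_objective p D (\<alpha>, \<gamma>, y))"
    and "0 < \<epsilon> \<Longrightarrow> \<exists>y. ((\<chi> x. \<alpha> $ x - \<epsilon>), \<gamma>, y) \<in> feasible (wz_gp p d D)"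
proof -
  have lam: "0 \<le> lam i" for i
    using feas by (auto simp: dual_feasible_def wz_problem_def)
  note nn = wz_slice_nonneg_of_dual_function[OF fin]
  have "dual_function (wz_problem p d D) lam mu = ereal (- lam Distortion * D - (\<Sum>x\<in>UNIV. mu x))"
    by (intro dual_function_wz_problem_eq nn)
  moreover have "prob_x p x * \<alpha> $ x = - mu x" for x
    using px[of x] by (simp add: \<alpha>_def)
  ultimately show "dual_function (wz_problem p d D) lam mu = ereal (wz_gp_objective p D (\<alpha>, \<gamma>, y))"
    by (simp add: \<gamma>_def wz_gp_objective_def sum_negf)
  assume \<epsilon>: "0 < \<epsilon>"
  have "\<exists>z. (\<forall>s. (\<Sum>x\<in>UNIV. exp (z x s)) \<le> 1) \<and> (\<forall>x. 0 \<le> wz_price p d lam mu t x + \<epsilon> * prob_x p x +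
          (\<Sum>s\<in>UNIV. pmf p (x, s) * (z x s - ln (prob_x_given_s p x s))))" for t
    by (rule wz_slice_minorant[OF px ps nn[of _ t] \<epsilon>]) auto
  then have "\<forall>t. \<exists>z. (\<forall>s. (\<Sum>x\<in>UNIV. exp (z x s)) \<le> 1) \<and> (\<forall>x. 0 \<le> wz_price p d lam mu t x + \<epsilon> * prob_x p x +
          (\<Sum>s\<in>UNIV. pmf p (x, s) * (z x s - ln (prob_x_given_s p x s))))"
    by blast
  from choice[OF this] obtain z where z: "\<And>t s. (\<Sum>x\<in>UNIV. exp (z t x s)) \<le> 1"
    "\<And>t x. 0 \<le> wz_price p d lam mu t x + \<epsilon> * prob_x p x +
          (\<Sum>s\<in>UNIV. pmf p (x, s) * (z t x s - ln (prob_x_given_s p x s)))"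
    by blast
  have "\<alpha> $ x - \<epsilon> + (\<Sum>s\<in>UNIV. prob_s_given_x p s x *
        (ln (prob_x_given_s p x s) - \<gamma> * d x (t s) - z t x s)) \<le> 0" for x t
  proof -
    have "prob_x p x * (\<alpha> $ x - \<epsilon> + (\<Sum>s\<in>UNIV. prob_s_given_x p s x *
        (ln (prob_x_given_s p x s) - \<gamma> * d x (t s) - z t x s))) =
        - mu x - \<epsilon> * prob_x p x + (\<Sum>s\<in>UNIV. pmf p (x, s) *
        (ln (prob_x_given_s p x s) - \<gamma> * d x (t s) - z t x s))"
      unfolding distrib_left prob_s_given_x_eq[OF px]
      using px[of x] by (simp add: right_diff_distrib[of "prob_x p x"] \<alpha>_def)
    \<comment> \<open>The multiplier of q(t|x) \<ge> 0 has a favourable sign and becomes slack in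
      the \<open>Alpha\<close> constraint.\<close>
    also have "\<dots> = - lam (Nonneg x t) - (wz_price p d lam mu t x + \<epsilon> * prob_x p x +
          (\<Sum>s\<in>UNIV. pmf p (x, s) * (z t x s - ln (prob_x_given_s p x s))))"
      by (simp add: wz_price_def \<gamma>_def sum_subtractf sum.distrib sum_distrib_left algebra_simps)
    also have "\<dots> \<le> 0" using z(2)[of t x] lam[of "Nonneg x t"] by linarith
    finally show ?thesis using px[of x] by (simp add: mult_le_0_iff)
  qed
  then show "\<exists>y. ((\<chi> x. \<alpha> $ x - \<epsilon>), \<gamma>, y) \<in> feasible (wz_gp p d D)"
    using z(1) lam by (intro exI[of _ "\<chi> x s t. z t x s"]) (simp add: feasible_wz_gp_iff \<gamma>_def)
qed

lemma sum_prob_x: "(\<Sum>x\<in>UNIV. prob_x p x) = 1"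
  unfolding prob_x_def by (rule sum_pmf_eq_1) auto

lemma wz_dual_value_eq: "dual_value (wz_problem p d D) = wz_gp_value p d D"
proof (rule antisym)
  show "dual_value (wz_problem p d D) \<le> wz_gp_value p d D"
    unfolding dual_value_def
  proof (rule SUP_least, safe)
    fix lam mu assume f: "(lam, mu) \<in> dual_feasible (wz_problem p d D)"
    show "dual_function (wz_problem p d D) lam mu \<le> wz_gp_value p d D"
    proof (cases "dual_function (wz_problem p d D) lam mu = - \<infinity>")
      case False
      define \<alpha> where "\<alpha> = (\<chi> x. - mu x / prob_x p x)"
      define \<gamma> where "\<gamma> = lam Distortion"
      note gp = gp_feasible_of_dual[OF f False, folded \<alpha>_def \<gamma>_def]
      show ?thesis
      proof (rule ereal_le_epsilon2)
        fix \<epsilon> :: real assume "0 < \<epsilon>"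
        then obtain y where y: "((\<chi> x. \<alpha> $ x - \<epsilon>), \<gamma>, y) \<in> feasible (wz_gp p d D)"
          using gp(2) by blast
        \<comment> \<open>As the p(x) sum to 1, lowering every component of \<alpha> by \<epsilon>
          costs exactly \<epsilon>.\<close>
        have "wz_gp_objective p D (\<alpha>, \<gamma>, y) = wz_gp_objective p D ((\<chi> x. \<alpha> $ x - \<epsilon>), \<gamma>, y) + \<epsilon>"
          by (simp add: wz_gp_objective_def right_diff_distrib sum_subtractf
              sum_distrib_right[symmetric] sum_prob_x)
        then have "dual_function (wz_problem p d D) lam mu =
            ereal (wz_gp_objective p D ((\<chi> x. \<alpha> $ x - \<epsilon>), \<gamma>, y)) + ereal \<epsilon>"
          using gp(1)[of y] by simp
        also have "\<dots> \<le> wz_gp_value p d D + ereal \<epsilon>"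
          unfolding wz_gp_value_def by (intro add_right_mono SUP_upper y)
        finally show "dual_function (wz_problem p d D) lam mu \<le> wz_gp_value p d D + ereal \<epsilon>" .
      qed
    qed simp
  qed
  show "wz_gp_value p d D \<le> dual_value (wz_problem p d D)"
    unfolding wz_gp_value_def
  proof (rule SUP_least)
    fix v assume v: "v \<in> feasible (wz_gp p d D)"
    obtain \<alpha> \<gamma> y where "v = (\<alpha>, \<gamma>, y)" by (cases v)
    with dual_of_gp_feasible[of \<alpha> \<gamma> y] v
    show "ereal (wz_gp_objective p D v) \<le> dual_value (wz_problem p d D)"
      unfolding dual_value_def by (auto intro: SUP_upper2)
  qed
qed

lemma wz_dual_equiv_gp: "wz_dual_equiv_gp p d D"
  unfolding wz_dual_equiv_gp_def Let_def
proof (intro conjI allI impI)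
  fix \<alpha> \<gamma> y assume f: "(\<alpha>, \<gamma>, y) \<in> feasible (wz_gp p d D)"
  show "(case_wz_ineq \<gamma> (\<lambda>_ _. 0), \<lambda>x. - prob_x p x * \<alpha> $ x) \<in> dual_feasible (wz_problem p d D)"
    by (rule dual_of_gp_feasible(1)[OF f])
  show "dual_function (wz_problem p d D) (case_wz_ineq \<gamma> (\<lambda>_ _. 0)) (\<lambda>x. - prob_x p x * \<alpha> $ x) =
      ereal (wz_gp_objective p D (\<alpha>, \<gamma>, y))"
    by (rule dual_of_gp_feasible(2)[OF f])
next
  fix lam mu and y :: "real^('s \<Rightarrow> 'r)^'s^'x"
  assume "(lam, mu) \<in> dual_feasible (wz_problem p d D) \<and>
    dual_function (wz_problem p d D) lam mu \<noteq> - \<infinity>"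
  then show "dual_function (wz_problem p d D) lam mu =
      ereal (wz_gp_objective p D (\<chi> x. - mu x / prob_x p x, lam Distortion, y))"
    using gp_feasible_of_dual(1) by blast
next
  fix lam mu and \<epsilon> :: real
  assume "(lam, mu) \<in> dual_feasible (wz_problem p d D) \<and>
    dual_function (wz_problem p d D) lam mu \<noteq> - \<infinity>" "0 < \<epsilon>"
  then show "\<exists>y. (\<chi> x. (\<chi> x. - mu x / prob_x p x) $ x - \<epsilon>, lam Distortion, y) \<in> feasible (wz_gp p d D)"
    using gp_feasible_of_dual(2) by blast
qed (rule wz_dual_value_eq)

end


section \<open>Strong duality\<close>

lemma weak_duality: "dual_value P \<le> optimal_value P"
  unfolding dual_value_def optimal_value_def
proof (rule SUP_least, rule INF_greatest, clarify)
  fix lam mu v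
  assume lam: "(lam, mu) \<in> dual_feasible P" and v: "v \<in> feasible P"
  have "(\<Sum>i\<in>ineqs P. lam i * ineq P i v) \<le> 0"
    using lam v by (intro sum_nonpos mult_nonneg_nonpos) (auto simp: dual_feasible_def feasible_def)
  moreover have "(\<Sum>j\<in>eqns P. mu j * eqn P j v) = 0"
    using v by (intro sum.neutral) (auto simp: feasible_def)
  ultimately have "lagrangian P v lam mu \<le> objective P v"
    by (simp add: lagrangian_def)
  then show "dual_function P lam mu \<le> ereal (objective P v)"
    unfolding dual_function_def using v by (intro INF_lower2[of v]) (auto simp: feasible_def)
qed

lemma wz_objective_convex:
  fixes p :: "('x::finite \<times> 's::finite) pmf" and q q' :: "real^('s \<Rightarrow> 'r::finite)^'x"
  assumes "\<And>s. 0 < prob_s p s" "\<And>x t. 0 \<le> q $ x $ t" "\<And>x t. 0 \<le> q' $ x $ t"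
    and "0 \<le> a" "0 \<le> b"
  shows "wz_objective p (a *\<^sub>R q + b *\<^sub>R q') \<le> a * wz_objective p q + b * wz_objective p q'"
  unfolding wz_objective_eq_slices sum_distrib_left sum.distrib[symmetric]
proof (rule sum_mono)
  fix t
  show "wz_slice p (\<lambda>x. (a *\<^sub>R q + b *\<^sub>R q') $ x $ t)
      \<le> a * wz_slice p (\<lambda>x. q $ x $ t) + b * wz_slice p (\<lambda>x. q' $ x $ t)"
    using wz_slice_sum_le[of "\<lambda>u x. (if u then q else q') $ x $ t" UNIV "\<lambda>u. if u then a else b" p] assms
    by (simp add: UNIV_bool add_ac)
qed

lemma wz_distortion_linear:
  "wz_distortion p d (a *\<^sub>R q + b *\<^sub>R q') = a * wz_distortion p d q + b * wz_distortion p d q'"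
  by (simp add: wz_distortion_eq_slices sum.distrib sum_distrib_left algebra_simps)

lemma feasible_wz_problem_iff:
  "q \<in> feasible (wz_problem p d D) \<longleftrightarrow>
     (\<forall>x t. 0 \<le> q $ x $ t) \<and> wz_distortion p d q \<le> D \<and> (\<forall>x. (\<Sum>t\<in>UNIV. q $ x $ t) = 1)"
  by (auto simp: feasible_def wz_problem_def split: wz_ineq.split)

text \<open>For each real r below the optimum, 0 is separated from the convex set of achievable
  perturbations, and the Slater point makes the hyperplane nonvertical. Its normal, divided by the
  objective component, yields multipliers with dual function at least r. Nonnegativity of q stays in
  the domain, with multipliers 0.\<close>

lemma wz_strong_duality:
  fixes p :: "('x::finite \<times> 's::finite) pmf" and d :: "'x \<Rightarrow> 'r::finite \<Rightarrow> real"
  assumes ps: "\<And>s. 0 < prob_s p s" and slater: "slater (wz_problem p d D)"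
  shows "strong_duality (wz_problem p d D)"
proof -
  let ?P = "wz_problem p d D"
  obtain q0 :: "real^('s \<Rightarrow> 'r)^'x" where q0: "\<And>x t. 0 \<le> q0 $ x $ t"
    "wz_distortion p d q0 < D" "\<And>x. (\<Sum>t\<in>UNIV. q0 $ x $ t) = 1"
  proof -
    obtain q where q: "q \<in> rel_interior (domain ?P)" "\<forall>i\<in>ineqs ?P. ineq ?P i q < 0"
      "\<forall>j\<in>eqns ?P. eqn ?P j q = 0"
      using slater by (auto simp: slater_def)
    have "q \<in> domain ?P" using q(1) rel_interior_subset by blast
    moreover have "ineq ?P i q < 0" for i using q(2) by (simp add: wz_problem_def)
    from this[of Distortion] have "wz_distortion p d q < D" by (simp add: wz_problem_def)
    ultimately show ?thesis using q(3) by (intro that[of q]) (simp_all add: wz_problem_def)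
  qed
  have "optimal_value ?P \<le> dual_value ?P"
  proof (rule dense_le)
    fix z assume z: "z < optimal_value ?P"
    show "z \<le> dual_value ?P"
    proof (cases z)
      case (real r)
      \<comment> \<open>The coordinates are excess distortion, defect of the row sums, and excess of
        the objective over r; the two inequalities leave room for slack.\<close>
      define A where "A = {(u, w, v). \<exists>q :: real^('s \<Rightarrow> 'r)^'x. (\<forall>x t. 0 \<le> q $ x $ t) \<and>
        wz_distortion p d q - D \<le> u \<and> w = (\<chi> x. (\<Sum>t\<in>UNIV. q $ x $ t) - 1) \<and>
        wz_objective p q - r \<le> v}"
      have AI: "(wz_distortion p d q - D + k, \<chi> x. (\<Sum>t\<in>UNIV. q $ x $ t) - 1, wz_objective p q - r + l) \<in> A"
        if "\<And>x t. 0 \<le> q $ x $ t" "0 \<le> k" "0 \<le> l" for q k l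
        using that unfolding A_def by (auto intro!: exI[of _ q])
      have "convex A"
      proof (rule convexI)
        fix z1 z2 :: "real \<times> (real^'x) \<times> real" and a b :: real
        assume z: "z1 \<in> A" "z2 \<in> A" and ab: "0 \<le> a" "0 \<le> b" "a + b = 1"
        obtain u1 w1 v1 where z1: "z1 = (u1, w1, v1)" by (cases z1)
        obtain u2 w2 v2 where z2: "z2 = (u2, w2, v2)" by (cases z2)
        from z(1) obtain q1 :: "real^('s \<Rightarrow> 'r)^'x" where q1: "\<And>x t. 0 \<le> q1 $ x $ t"
          "wz_distortion p d q1 - D \<le> u1" "w1 = (\<chi> x. (\<Sum>t\<in>UNIV. q1 $ x $ t) - 1)"
          "wz_objective p q1 - r \<le> v1" by (auto simp: A_def z1)
        from z(2) obtain q2 :: "real^('s \<Rightarrow> 'r)^'x" where q2: "\<And>x t. 0 \<le> q2 $ x $ t"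
          "wz_distortion p d q2 - D \<le> u2" "w2 = (\<chi> x. (\<Sum>t\<in>UNIV. q2 $ x $ t) - 1)"
          "wz_objective p q2 - r \<le> v2" by (auto simp: A_def z2)
        let ?q = "a *\<^sub>R q1 + b *\<^sub>R q2"
        have split: "c = a * c + b * c" for c :: real
          using ab(3) by (simp flip: distrib_right)
        have "wz_distortion p d ?q - D = a * (wz_distortion p d q1 - D) + b * (wz_distortion p d q2 - D)"
          unfolding wz_distortion_linear by (subst split[of D]) (simp add: algebra_simps)
        also have "\<dots> \<le> a * u1 + b * u2"
          using q1(2) q2(2) ab by (intro add_mono mult_left_mono)
        finally have 1: "wz_distortion p d ?q - D \<le> a * u1 + b * u2" .
        have 2: "a *\<^sub>R w1 + b *\<^sub>R w2 = (\<chi> x. (\<Sum>t\<in>UNIV. ?q $ x $ t) - 1)"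
          using split[of 1] by (simp add: q1(3) q2(3) vec_eq_iff sum.distrib sum_distrib_left algebra_simps)
        have "wz_objective p ?q - r \<le> a * wz_objective p q1 + b * wz_objective p q2 - r"
          using wz_objective_convex[OF ps q1(1) q2(1) ab(1,2)] by simp
        also have "\<dots> = a * (wz_objective p q1 - r) + b * (wz_objective p q2 - r)"
          by (subst split[of r]) (simp add: algebra_simps)
        also have "\<dots> \<le> a * v1 + b * v2"
          using q1(4) q2(4) ab by (intro add_mono mult_left_mono)
        finally have 3: "wz_objective p ?q - r \<le> a * v1 + b * v2" .
        have "0 \<le> ?q $ x $ t" for x t
          using q1(1) q2(1) ab by simp
        then show "a *\<^sub>R z1 + b *\<^sub>R z2 \<in> A"
          using 1 2 3 unfolding A_def z1 z2 by (auto intro!: exI[of _ ?q])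
      qed
      moreover have "0 \<notin> A"
      proof
        assume "0 \<in> A"
        then obtain q :: "real^('s \<Rightarrow> 'r)^'x" where q: "\<And>x t. 0 \<le> q $ x $ t"
          "wz_distortion p d q - D \<le> 0" "0 = (\<chi> x. (\<Sum>t\<in>UNIV. q $ x $ t) - 1)"
          "wz_objective p q - r \<le> 0" by (auto simp: A_def zero_prod_def)
        have "(\<Sum>t\<in>UNIV. q $ x $ t) = 1" for x
          using q(3) by (simp add: vec_eq_iff)
        then have "q \<in> feasible ?P"
          using q(1,2) by (simp add: feasible_wz_problem_iff)
        then have "optimal_value ?P \<le> ereal (objective ?P q)"
          unfolding optimal_value_def by (rule INF_lower)
        also have "\<dots> \<le> z" using q(4) real by (simp add: wz_problem_def)
        finally show False using z by simp
      qed
      ultimately obtain g m \<kappa> where ne: "(g, m, \<kappa>) \<noteq> 0"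
        and sep: "\<And>u w v. (u, w, v) \<in> A \<Longrightarrow> 0 \<le> g * u + m \<bullet> w + \<kappa> * v"
        using separating_hyperplane_set_0[of A] by (force simp: inner_Pair)
      have base: "0 \<le> g * (wz_distortion p d q - D + k) +
          m \<bullet> (\<chi> x. (\<Sum>t\<in>UNIV. q $ x $ t) - 1) + \<kappa> * (wz_objective p q - r + l)"
        if "\<And>x t. 0 \<le> q $ x $ t" "0 \<le> k" "0 \<le> l" for q k l
        using sep[OF AI[OF that]] by simp
      \<comment> \<open>An affine function that is nonnegative on a half-line has nonnegative slope;
        applied to the two slacks this gives the signs of \<open>g\<close> and \<kappa>.\<close>
      have ray: "0 \<le> e" if "\<And>k. 0 \<le> k \<Longrightarrow> 0 \<le> c + e * k" for c e :: real
      proof (rule ccontr)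
        assume "\<not> 0 \<le> e"
        then show False
          using that[of "(\<bar>c\<bar> + 1) / - e"] divide_nonneg_pos[of "\<bar>c\<bar> + 1" "- e"] by simp
      qed
      have g: "0 \<le> g"
        by (rule ray[of "g * (wz_distortion p d q0 - D) + m \<bullet> (\<chi> x. (\<Sum>t\<in>UNIV. q0 $ x $ t) - 1) +
              \<kappa> * (wz_objective p q0 - r)"])
          (use base[OF q0(1), of _ 0] in \<open>simp add: algebra_simps\<close>)
      have "0 \<le> \<kappa>"
        by (rule ray[of "g * (wz_distortion p d q0 - D) + m \<bullet> (\<chi> x. (\<Sum>t\<in>UNIV. q0 $ x $ t) - 1) +
              \<kappa> * (wz_objective p q0 - r)"])
          (use base[OF q0(1), of 0] in \<open>simp add: algebra_simps\<close>)
      \<comment> \<open>If \<kappa> vanished, strictness of the distortion bound at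
        \<open>q0\<close> would force g = 0, and a suitable \<open>q\<close> would then force m =
        0.\<close>
      moreover have "\<kappa> \<noteq> 0"
      proof
        assume \<kappa>: "\<kappa> = 0"
        have "(\<chi> x. (\<Sum>t\<in>UNIV. q0 $ x $ t) - 1) = 0"
          using q0(3) by (simp add: vec_eq_iff)
        then have "0 \<le> g * (wz_distortion p d q0 - D)"
          using base[OF q0(1), of 0 0] \<kappa> by simp
        then have g0: "g = 0"
          using g q0(2) by (simp add: zero_le_mult_iff)
        define n where "n = norm m + 1"
        have n: "0 < n" by (simp add: n_def add_nonneg_pos)
        \<comment> \<open>All mass sits on one arbitrary map. The row sums are off by - m / n, and n
          > norm m keeps \<open>q\<close> nonnegative.\<close>
        define q :: "real^('s \<Rightarrow> 'r)^'x" where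
          "q = (\<chi> x t. if t = (\<lambda>_. undefined) then 1 - m $ x / n else 0)"
        have "0 \<le> q $ x $ t" for x t
        proof -
          have "m $ x \<le> n" using component_le_norm_cart[of m x] by (simp add: n_def)
          then show ?thesis using n by (simp add: q_def)
        qed
        from base[OF this, of 0 0] have "0 \<le> m \<bullet> (\<chi> x. (\<Sum>t\<in>UNIV. q $ x $ t) - 1)"
          by (simp add: \<kappa> g0)
        also have "(\<chi> x. (\<Sum>t\<in>UNIV. q $ x $ t) - 1) = (- 1 / n) *\<^sub>R m"
          by (simp add: q_def vec_eq_iff)
        finally have "m \<bullet> m \<le> 0" using n by (simp add: divide_le_0_iff)
        then have "m = 0" by (metis antisym inner_eq_zero_iff inner_ge_zero)
        then show False using ne g0 \<kappa> by (simp add: zero_prod_def)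
      qed
      ultimately have \<kappa>: "0 < \<kappa>" by simp
      define lam where "lam = (case_wz_ineq (g / \<kappa>) (\<lambda>_ _. 0) :: ('x, 's \<Rightarrow> 'r) wz_ineq \<Rightarrow> real)"
      define mu where "mu x = m $ x / \<kappa>" for x
      have "(lam, mu) \<in> dual_feasible ?P"
        using g \<kappa> by (auto simp: dual_feasible_def lam_def split: wz_ineq.split)
      moreover have "ereal r \<le> dual_function ?P lam mu"
        unfolding dual_function_def
      proof (rule INF_greatest)
        fix q assume "q \<in> domain ?P"
        then have q: "\<And>x t. 0 \<le> q $ x $ t" by (simp add: domain_wz_problem)
        have "lagrangian ?P q lam mu = wz_objective p q + g / \<kappa> * (wz_distortion p d q - D) +
            (\<Sum>x\<in>UNIV. m $ x * ((\<Sum>t\<in>UNIV. q $ x $ t) - 1)) / \<kappa>"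
          by (simp add: lagrangian_def wz_problem_def sum_wz_ineq lam_def mu_def sum_divide_distrib)
        then have "\<kappa> * (lagrangian ?P q lam mu - r) = g * (wz_distortion p d q - D) +
            m \<bullet> (\<chi> x. (\<Sum>t\<in>UNIV. q $ x $ t) - 1) + \<kappa> * (wz_objective p q - r)"
          using \<kappa> by (simp add: inner_vec_def distrib_left right_diff_distrib[of \<kappa>])
        also have "\<dots> \<ge> 0" using base[OF q, of 0 0] by simp
        finally show "ereal r \<le> ereal (lagrangian ?P q lam mu)"
          using \<kappa> by (simp add: zero_le_mult_iff)
      qed
      ultimately show ?thesis
        unfolding dual_value_def real by (intro SUP_upper2[of "(lam, mu)"]) simp_all
    qed (use z in auto)
  qed
  then show ?thesis
    unfolding strong_duality_def using weak_duality by (rule antisym)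
qed


section \<open>The Wyner-Ziv function\<close>

lemma distributed_pmf: "distributed (measure_pmf J) (count_space UNIV) X (\<lambda>x. ennreal (pmf (map_pmf X J) x))"
  by (simp add: distributed_def map_pmf_rep_eq[symmetric] measure_pmf_eq_density[symmetric])

lemma integral_count_space_pmf:
  fixes f :: "'a \<Rightarrow> real"
  shows "(\<integral>x. pmf M x * f x \<partial>count_space UNIV) = measure_pmf.expectation M f"
  by (subst measure_pmf_eq_density, subst integral_real_density) auto

lemma integrable_count_space_pmf:
  fixes f :: "'a \<Rightarrow> real"
  assumes "finite (set_pmf M)"
  shows "integrable (count_space UNIV) (\<lambda>x. pmf M x * f x)"
  using integrable_measure_pmf_finite[OF assms, of f]
  by (subst (asm) measure_pmf_eq_density, subst (asm) integrable_real_density) auto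

text \<open>On countable types a product of counting measures is a counting measure, so the general
  density formula applies with PMFs as densities; finite support gives integrability.\<close>

lemma conditional_mutual_information_pmf:
  fixes J :: "'a pmf" and X :: "'a \<Rightarrow> 'b" and Y :: "'a \<Rightarrow> 'c" and Z :: "'a \<Rightarrow> 'd"
  assumes fin: "finite (set_pmf J)" and b: "1 < b"
    and ct: "countable (UNIV :: 'b set)" "countable (UNIV :: 'c set)" "countable (UNIV :: 'd set)"
  shows "prob_space.conditional_mutual_information (measure_pmf J) b
      (count_space UNIV) (count_space UNIV) (count_space UNIV) X Y Z =
    measure_pmf.expectation J (\<lambda>w. log b (pmf (map_pmf (\<lambda>w. (X w, Y w, Z w)) J) (X w, Y w, Z w) /
      (pmf (map_pmf (\<lambda>w. (X w, Z w)) J) (X w, Z w) *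
        (pmf (map_pmf (\<lambda>w. (Y w, Z w)) J) (Y w, Z w) / pmf (map_pmf Z J) (Z w)))))"
proof -
  interpret information_space "measure_pmf J" b
    by (rule information_space.intro) (unfold_locales, simp_all add: b information_space_axioms_def)
  have pairs: "count_space (UNIV :: 'c set) \<Otimes>\<^sub>M count_space (UNIV :: 'd set) = count_space UNIV"
    "count_space (UNIV :: 'b set) \<Otimes>\<^sub>M count_space (UNIV :: 'd set) = count_space UNIV"
    "count_space (UNIV :: 'b set) \<Otimes>\<^sub>M count_space (UNIV :: ('c \<times> 'd) set) = count_space UNIV"
    using ct countable_SIGMA[OF ct(2), of "\<lambda>_. UNIV :: 'd set"] ct(3)
    by (simp_all add: pair_measure_countable)
  let ?f = "\<lambda>x y z. log b (pmf (map_pmf (\<lambda>w. (X w, Y w, Z w)) J) (x, y, z) /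
      (pmf (map_pmf (\<lambda>w. (X w, Z w)) J) (x, z) *
        (pmf (map_pmf (\<lambda>w. (Y w, Z w)) J) (y, z) / pmf (map_pmf Z J) z)))"
  have "prob_space.conditional_mutual_information (measure_pmf J) b (count_space UNIV) (count_space UNIV) (count_space UNIV) X Y Z =
    (\<integral>(x, y, z). pmf (map_pmf (\<lambda>w. (X w, Y w, Z w)) J) (x, y, z) * ?f x y z
      \<partial>(count_space UNIV \<Otimes>\<^sub>M count_space UNIV \<Otimes>\<^sub>M count_space UNIV))"
  proof (rule conditional_mutual_information_generic_eq[where Px = "pmf (map_pmf X J)"
        and Pz = "pmf (map_pmf Z J)" and Pyz = "pmf (map_pmf (\<lambda>w. (Y w, Z w)) J)"
        and Pxz = "pmf (map_pmf (\<lambda>w. (X w, Z w)) J)"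
        and Pxyz = "pmf (map_pmf (\<lambda>w. (X w, Y w, Z w)) J)"])
    have I: "integrable (count_space UNIV) (\<lambda>w. pmf (map_pmf (\<lambda>w. (X w, Y w, Z w)) J) w * f w)"
      for f :: "_ \<Rightarrow> real"
      using fin by (intro integrable_count_space_pmf) simp
    show "integrable (count_space UNIV \<Otimes>\<^sub>M count_space UNIV \<Otimes>\<^sub>M count_space UNIV)
      (\<lambda>(x, y, z). pmf (map_pmf (\<lambda>w. (X w, Y w, Z w)) J) (x, y, z) *
        log b (pmf (map_pmf (\<lambda>w. (X w, Y w, Z w)) J) (x, y, z) /
          (pmf (map_pmf X J) x * pmf (map_pmf (\<lambda>w. (Y w, Z w)) J) (y, z))))"
      unfolding pairs case_prod_unfold prod.collapse by (rule I)
    show "integrable (count_space UNIV \<Otimes>\<^sub>M count_space UNIV \<Otimes>\<^sub>M count_space UNIV)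
      (\<lambda>(x, y, z). pmf (map_pmf (\<lambda>w. (X w, Y w, Z w)) J) (x, y, z) *
        log b (pmf (map_pmf (\<lambda>w. (X w, Z w)) J) (x, z) / (pmf (map_pmf X J) x * pmf (map_pmf Z J) z)))"
      unfolding pairs case_prod_unfold prod.collapse by (rule I)
  qed (simp_all only: pairs distributed_pmf pmf_nonneg sigma_finite_measure_count_space_countable ct)
  also have "\<dots> = (\<integral>w. pmf (map_pmf (\<lambda>w. (X w, Y w, Z w)) J) w * (case w of (x, y, z) \<Rightarrow> ?f x y z)
      \<partial>count_space UNIV)"
    by (simp add: pairs case_prod_unfold)
  also have "\<dots> = measure_pmf.expectation (map_pmf (\<lambda>w. (X w, Y w, Z w)) J)
      (\<lambda>w. case w of (x, y, z) \<Rightarrow> ?f x y z)"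
    by (rule integral_count_space_pmf)
  finally show ?thesis by simp
qed

lemma expectation_wz_law:
  fixes p :: "('x::finite \<times> 's::finite) pmf" and V :: "'u \<Rightarrow> 's \<Rightarrow> 'r::finite pmf"
    and f :: "'x \<times> 's \<times> 'u \<times> 'r \<Rightarrow> real"
  assumes A: "finite A" "\<And>x. set_pmf (W x) \<subseteq> A"
  shows "measure_pmf.expectation (wz_law p W V) f =
    (\<Sum>x\<in>UNIV. \<Sum>s\<in>UNIV. \<Sum>u\<in>A. \<Sum>r\<in>UNIV.
       pmf p (x, s) * pmf (W x) u * pmf (V u s) r * f (x, s, u, r))"
proof -
  have W: "finite (set_pmf (W x))" for x
    using A finite_subset by blast
  have V: "measure_pmf.expectation (V u s) (\<lambda>r. f (x, s, u, r)) =
      (\<Sum>r\<in>UNIV. pmf (V u s) r * f (x, s, u, r))" for x s u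
    by (simp add: integral_measure_pmf_real[of UNIV] mult.commute)
  have "measure_pmf.expectation (wz_law p W V) f =
    (\<Sum>(x, s)\<in>UNIV. pmf p (x, s) * (\<Sum>u\<in>A. pmf (W x) u * (\<Sum>r\<in>UNIV. pmf (V u s) r * f (x, s, u, r))))"
    unfolding wz_law_def using A W
    by (subst pmf_expectation_bind[of UNIV])
      (auto simp: case_prod_unfold V pmf_expectation_bind[of A] intro!: sum.cong)
  also have "\<dots> = (\<Sum>x\<in>UNIV. \<Sum>s\<in>UNIV. pmf p (x, s) *
      (\<Sum>u\<in>A. pmf (W x) u * (\<Sum>r\<in>UNIV. pmf (V u s) r * f (x, s, u, r))))"
    by (simp add: sum.cartesian_product)
  finally show ?thesis by (simp add: sum_distrib_left mult_ac)
qed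

lemma pmf_map_wz_law:
  fixes p :: "('x::finite \<times> 's::finite) pmf" and V :: "'u \<Rightarrow> 's \<Rightarrow> 'r::finite pmf"
  assumes A: "finite A" "\<And>x. set_pmf (W x) \<subseteq> A"
  shows "pmf (map_pmf (\<lambda>(x, s, u, r). g x s u) (wz_law p W V)) a =
    (\<Sum>x\<in>UNIV. \<Sum>s\<in>UNIV. \<Sum>u\<in>A. pmf p (x, s) * pmf (W x) u * of_bool (g x s u = a))"
proof -
  have ind: "(\<lambda>(x, s, u, r). of_bool (g x s u = a)) =
      (indicator ((\<lambda>(x, s, u, r). g x s u) -` {a}) :: 'x \<times> 's \<times> 'u \<times> 'r \<Rightarrow> real)"
    by (auto simp: fun_eq_iff indicator_def)
  have "pmf (map_pmf (\<lambda>(x, s, u, r). g x s u) (wz_law p W V)) a =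
      measure_pmf.expectation (wz_law p W V) (\<lambda>(x, s, u, r). of_bool (g x s u = a))"
    unfolding ind by (simp add: pmf_map)
  also have "\<dots> = (\<Sum>x\<in>UNIV. \<Sum>s\<in>UNIV. \<Sum>u\<in>A. \<Sum>r\<in>UNIV.
       pmf (V u s) r * (pmf p (x, s) * pmf (W x) u * of_bool (g x s u = a)))"
    by (simp add: expectation_wz_law[OF A] mult_ac)
  also have "\<dots> = (\<Sum>x\<in>UNIV. \<Sum>s\<in>UNIV. \<Sum>u\<in>A. pmf p (x, s) * pmf (W x) u * of_bool (g x s u = a))"
    by (simp add: sum_distrib_right[symmetric] sum_pmf_eq_1)
  finally show ?thesis .
qed

lemma sum_if_const:
  "(\<Sum>i\<in>A. if P then f i else 0) = (if P then \<Sum>i\<in>A. f i else 0)"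
  by simp

text \<open>The joint law of (U, X, S) is p(x, s) W(u|x), and p(x, s) cancels inside the logarithm.
  The rate thus has the shape of the objective over test channels, with \<open>u\<close> in place of
  \<open>t\<close>.\<close>

lemma wz_rate_eq_slices:
  fixes p :: "('x::finite \<times> 's::finite) pmf" and W :: "'x \<Rightarrow> nat pmf" and V :: "nat \<Rightarrow> 's \<Rightarrow> 'r::finite pmf"
  assumes A: "finite A" "\<And>x. set_pmf (W x) \<subseteq> A" and ps: "\<And>s. 0 < prob_s p s"
  shows "wz_rate (wz_law p W V) = (\<Sum>u\<in>A. wz_slice p (\<lambda>x. pmf (W x) u))"
proof -
  let ?J = "wz_law p W V"
  have fin: "finite (set_pmf ?J)"
    unfolding wz_law_def using finite_subset[OF A(2) A(1)] by auto
  have W1: "(\<Sum>u\<in>A. pmf (W x) u) = 1" for x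
    using A by (intro sum_pmf_eq_1) auto
  have uxs: "pmf (map_pmf (\<lambda>(x, s, u, r). (u, x, s)) ?J) (u, x, s) = pmf p (x, s) * pmf (W x) u"
    if "u \<in> A" for u x s
  proof -
    \<comment> \<open>The indicator of equal triples becomes nested conditionals, so that the sums
      collapse one after another.\<close>
    have "pmf (map_pmf (\<lambda>(x, s, u, r). (u, x, s)) ?J) (u, x, s) =
        (\<Sum>x'\<in>UNIV. \<Sum>s'\<in>UNIV. \<Sum>u'\<in>A. if x' = x then if s' = s then if u' = u then
          pmf p (x, s) * pmf (W x) u else 0 else 0 else 0)"
      by (subst pmf_map_wz_law[OF A], intro sum.cong refl) auto
    then show ?thesis using that A by (simp add: sum_if_const)
  qed
  have us: "pmf (map_pmf (\<lambda>(x, s, u, r). (u, s)) ?J) (u, s) = (\<Sum>x\<in>UNIV. pmf p (x, s) * pmf (W x) u)"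
    if "u \<in> A" for u s
  proof -
    have "pmf (map_pmf (\<lambda>(x, s, u, r). (u, s)) ?J) (u, s) =
        (\<Sum>x'\<in>UNIV. \<Sum>s'\<in>UNIV. \<Sum>u'\<in>A. if s' = s then if u' = u then
          pmf p (x', s) * pmf (W x') u else 0 else 0)"
      by (subst pmf_map_wz_law[OF A], intro sum.cong refl) auto
    then show ?thesis using that A by (simp add: sum_if_const)
  qed
  have xs: "pmf (map_pmf (\<lambda>(x, s, u, r). (x, s)) ?J) (x, s) = pmf p (x, s)" for x s
  proof -
    have "pmf (map_pmf (\<lambda>(x, s, u, r). (x, s)) ?J) (x, s) =
        (\<Sum>x'\<in>UNIV. \<Sum>s'\<in>UNIV. pmf p (x', s') * of_bool ((x', s') = (x, s)) * (\<Sum>u'\<in>A. pmf (W x') u'))"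
      by (subst pmf_map_wz_law[OF A]) (simp add: sum_distrib_left sum_distrib_right mult_ac)
    also have "\<dots> = (\<Sum>x'\<in>UNIV. \<Sum>s'\<in>UNIV. if x' = x then if s' = s then pmf p (x, s) else 0 else 0)"
      by (intro sum.cong refl) (simp add: W1)
    finally show ?thesis by (simp add: sum_if_const)
  qed
  have s: "pmf (map_pmf (\<lambda>(x, s, u, r). s) ?J) s = prob_s p s" for s
  proof -
    have "pmf (map_pmf (\<lambda>(x, s, u, r). s) ?J) s =
        (\<Sum>x'\<in>UNIV. \<Sum>s'\<in>UNIV. pmf p (x', s') * of_bool (s' = s) * (\<Sum>u'\<in>A. pmf (W x') u'))"
      by (subst pmf_map_wz_law[OF A]) (simp add: sum_distrib_left sum_distrib_right mult_ac)
    also have "\<dots> = (\<Sum>x'\<in>UNIV. \<Sum>s'\<in>UNIV. if s' = s then pmf p (x', s) else 0)"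
      by (intro sum.cong refl) (simp add: W1)
    finally show ?thesis by (simp add: prob_s_eq_sum)
  qed
  have "wz_rate ?J = measure_pmf.expectation ?J (\<lambda>(x, s, u, r).
      ln (pmf (map_pmf (\<lambda>(x, s, u, r). (u, x, s)) ?J) (u, x, s) /
        (pmf (map_pmf (\<lambda>(x, s, u, r). (u, s)) ?J) (u, s) *
          (pmf (map_pmf (\<lambda>(x, s, u, r). (x, s)) ?J) (x, s) / pmf (map_pmf (\<lambda>(x, s, u, r). s) ?J) s))))"
    unfolding wz_rate_def
    by (subst conditional_mutual_information_pmf[OF fin])
      (auto simp: log_def case_prod_unfold intro: countable_finite)
  also have "\<dots> = (\<Sum>x\<in>UNIV. \<Sum>s\<in>UNIV. \<Sum>u\<in>A. \<Sum>r\<in>UNIV. pmf (V u s) r *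
      (pmf p (x, s) * pmf (W x) u * ln (pmf p (x, s) * pmf (W x) u /
        ((\<Sum>x\<in>UNIV. pmf p (x, s) * pmf (W x) u) * (pmf p (x, s) / prob_s p s)))))"
    unfolding expectation_wz_law[OF A] by (intro sum.cong refl) (simp add: uxs us xs s)
  also have "\<dots> = (\<Sum>x\<in>UNIV. \<Sum>s\<in>UNIV. \<Sum>u\<in>A.
      pmf p (x, s) * pmf (W x) u * ln (pmf p (x, s) * pmf (W x) u /
        ((\<Sum>x\<in>UNIV. pmf p (x, s) * pmf (W x) u) * (pmf p (x, s) / prob_s p s))))"
    by (simp add: sum_distrib_right[symmetric] sum_pmf_eq_1)
  also have "\<dots> = (\<Sum>x\<in>UNIV. \<Sum>s\<in>UNIV. \<Sum>u\<in>A.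
      pmf p (x, s) * pmf (W x) u * ln (pmf (W x) u /
        ((\<Sum>x\<in>UNIV. pmf p (x, s) * pmf (W x) u) / prob_s p s)))"
  proof (intro sum.cong refl)
    fix x s u
    show "pmf p (x, s) * pmf (W x) u * ln (pmf p (x, s) * pmf (W x) u /
        ((\<Sum>x\<in>UNIV. pmf p (x, s) * pmf (W x) u) * (pmf p (x, s) / prob_s p s))) =
      pmf p (x, s) * pmf (W x) u * ln (pmf (W x) u /
        ((\<Sum>x\<in>UNIV. pmf p (x, s) * pmf (W x) u) / prob_s p s))"
      by (cases "pmf p (x, s) = 0") simp_all
  qed
  also have "\<dots> = (\<Sum>x\<in>UNIV. \<Sum>u\<in>A. \<Sum>s\<in>UNIV.
      pmf p (x, s) * pmf (W x) u * ln (pmf (W x) u /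
        ((\<Sum>x\<in>UNIV. pmf p (x, s) * pmf (W x) u) / prob_s p s)))"
    by (intro sum.cong refl sum.swap)
  also have "\<dots> = (\<Sum>u\<in>A. wz_slice p (\<lambda>x. pmf (W x) u))"
    unfolding wz_slice_def by (rule sum.swap)
  finally show ?thesis .
qed

section \<open>Random maps with independent components\<close>

text \<open>Distributivity: expanding a product of sums picks one \<open>r\<close> for every
  \<open>s\<close>, which is a map.\<close>

lemma sum_fun_prod:
  fixes f :: "'s::finite \<Rightarrow> 'r::finite \<Rightarrow> real"
  shows "(\<Sum>t\<in>UNIV. \<Prod>s\<in>UNIV. f s (t s)) = (\<Prod>s\<in>UNIV. \<Sum>r\<in>UNIV. f s r)"
  using prod_sum_PiE[of "UNIV :: 's set" "\<lambda>_. UNIV :: 'r set" f] by simp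

text \<open>
  The product kernel \<open>\<Prod>\<^sub>s V(t(s)|u,s)\<close> turns \<open>U\<close> into a random map \<open>T\<close> with \<open>T(s) \<sim> V(u,s)\<close>.
\<close>

definition map_kernel :: "('u \<Rightarrow> 's::finite \<Rightarrow> 'r pmf) \<Rightarrow> 'u \<Rightarrow> ('s \<Rightarrow> 'r) \<Rightarrow> real" where
  "map_kernel V u t = (\<Prod>s\<in>UNIV. pmf (V u s) (t s))"

lemma map_kernel_nonneg: "0 \<le> map_kernel V u t"
  by (simp add: map_kernel_def prod_nonneg)

lemma sum_map_kernel:
  fixes V :: "'u \<Rightarrow> 's::finite \<Rightarrow> 'r::finite pmf"
  shows "(\<Sum>t\<in>UNIV. map_kernel V u t) = 1"
  by (simp add: map_kernel_def sum_fun_prod[of "\<lambda>s. pmf (V u s)"] sum_pmf_eq_1)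

text \<open>The component T(s) has law V(u, s), because the factors at all other positions sum to
  1.\<close>

lemma sum_map_kernel_component:
  fixes V :: "'u \<Rightarrow> 's::finite \<Rightarrow> 'r::finite pmf"
  shows "(\<Sum>t\<in>UNIV. map_kernel V u t * g (t s)) = (\<Sum>r\<in>UNIV. pmf (V u s) r * g r)"
proof -
  \<comment> \<open>The value of \<open>g\<close> is written as a product with factor 1 away from
    \<open>s\<close>, so that \<open>sum_fun_prod\<close> applies.\<close>
  have "map_kernel V u t * g (t s) = (\<Prod>s'\<in>UNIV. pmf (V u s') (t s') * (if s' = s then g (t s') else 1))" for t
    by (simp add: map_kernel_def prod.distrib prod.delta)
  then have "(\<Sum>t\<in>UNIV. map_kernel V u t * g (t s)) =
      (\<Prod>s'\<in>UNIV. \<Sum>r\<in>UNIV. pmf (V u s') r * (if s' = s then g r else 1))"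
    by (simp add: sum_fun_prod[of "\<lambda>s' r. pmf (V u s') r * (if s' = s then g r else 1)"])
  also have "\<dots> = (\<Prod>s'\<in>UNIV. if s' = s then \<Sum>r\<in>UNIV. pmf (V u s) r * g r else 1)"
    by (intro prod.cong refl) (simp add: sum_pmf_eq_1)
  finally show ?thesis by simp
qed

lemma expected_distortion_wz_law:
  fixes p :: "('x::finite \<times> 's::finite) pmf" and V :: "'u \<Rightarrow> 's \<Rightarrow> 'r::finite pmf"
  assumes A: "finite A" "\<And>x. set_pmf (W x) \<subseteq> A"
  shows "measure_pmf.expectation (wz_law p W V) (\<lambda>(x, s, u, r). d x r) =
    (\<Sum>x\<in>UNIV. \<Sum>s\<in>UNIV. \<Sum>u\<in>A. pmf p (x, s) * pmf (W x) u * (\<Sum>r\<in>UNIV. pmf (V u s) r * d x r))"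
  unfolding expectation_wz_law[OF A] by (simp add: sum_distrib_left mult_ac)

text \<open>Distortion sees only single components of the map, so it is preserved. For the rate,
  \<open>wz_slice_sum_le\<close> is used with the kernel as weights, which sum to 1 over the
  maps.\<close>

lemma optimal_value_le_wyner_ziv:
  fixes p :: "('x::finite \<times> 's::finite) pmf" and d :: "'x \<Rightarrow> 'r::finite \<Rightarrow> real"
  assumes ps: "\<And>s. 0 < prob_s p s"
  shows "optimal_value (wz_problem p d D) \<le> wyner_ziv p d D"
  unfolding wyner_ziv_def
proof (rule Inf_greatest, clarify)
  fix W :: "'x \<Rightarrow> nat pmf" and V :: "nat \<Rightarrow> 's \<Rightarrow> 'r pmf"
  assume W: "\<forall>x. finite (set_pmf (W x))"
    and D: "measure_pmf.expectation (wz_law p W V) (\<lambda>(x, s, u, r). d x r) \<le> D"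
  define A where "A = (\<Union>x. set_pmf (W x))"
  have A: "finite A" "\<And>x. set_pmf (W x) \<subseteq> A" using W by (auto simp: A_def)
  define q :: "real^('s \<Rightarrow> 'r)^'x" where "q = (\<chi> x t. \<Sum>u\<in>A. map_kernel V u t * pmf (W x) u)"
  have "(\<Sum>t\<in>UNIV. q $ x $ t) = 1" for x
  proof -
    have "(\<Sum>t\<in>UNIV. q $ x $ t) = (\<Sum>u\<in>A. \<Sum>t\<in>UNIV. map_kernel V u t * pmf (W x) u)"
      unfolding q_def by (simp add: sum.swap[of _ A])
    also have "\<dots> = (\<Sum>u\<in>A. pmf (W x) u)"
      by (simp add: sum_distrib_right[symmetric] sum_map_kernel)
    finally show ?thesis using A by (simp add: sum_pmf_eq_1)
  qed
  moreover have "wz_distortion p d q = measure_pmf.expectation (wz_law p W V) (\<lambda>(x, s, u, r). d x r)"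
  proof -
    have "(\<Sum>t\<in>UNIV. pmf p (x, s) * q $ x $ t * d x (t s)) =
        (\<Sum>u\<in>A. pmf p (x, s) * pmf (W x) u * (\<Sum>r\<in>UNIV. pmf (V u s) r * d x r))" for x s
    proof -
      have "(\<Sum>t\<in>UNIV. pmf p (x, s) * q $ x $ t * d x (t s)) =
          (\<Sum>t\<in>UNIV. \<Sum>u\<in>A. pmf p (x, s) * pmf (W x) u * (map_kernel V u t * d x (t s)))"
        by (simp add: q_def sum_distrib_left sum_distrib_right mult_ac)
      also have "\<dots> = (\<Sum>u\<in>A. pmf p (x, s) * pmf (W x) u * (\<Sum>t\<in>UNIV. map_kernel V u t * d x (t s)))"
        by (subst sum.swap) (simp add: sum_distrib_left)
      finally show ?thesis by (simp add: sum_map_kernel_component)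
    qed
    then show ?thesis
      by (simp add: wz_distortion_def expected_distortion_wz_law[OF A])
  qed
  ultimately have "q \<in> feasible (wz_problem p d D)"
    using D by (auto simp: feasible_wz_problem_iff q_def intro!: sum_nonneg mult_nonneg_nonneg map_kernel_nonneg)
  then have "optimal_value (wz_problem p d D) \<le> ereal (objective (wz_problem p d D) q)"
    unfolding optimal_value_def by (rule INF_lower)
  also have "objective (wz_problem p d D) q = (\<Sum>t\<in>UNIV. wz_slice p (\<lambda>x. \<Sum>u\<in>A. map_kernel V u t * pmf (W x) u))"
    by (simp add: wz_problem_def wz_objective_eq_slices q_def)
  also have "ereal \<dots> \<le> ereal (wz_rate (wz_law p W V))"
  proof -
    have "(\<Sum>t\<in>UNIV. wz_slice p (\<lambda>x. \<Sum>u\<in>A. map_kernel V u t * pmf (W x) u)) \<le>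
        (\<Sum>t\<in>UNIV. \<Sum>u\<in>A. map_kernel V u t * wz_slice p (\<lambda>x. pmf (W x) u))"
      using ps map_kernel_nonneg by (intro sum_mono wz_slice_sum_le) auto
    also have "\<dots> = (\<Sum>u\<in>A. wz_slice p (\<lambda>x. pmf (W x) u))"
      by (subst sum.swap) (simp add: sum_distrib_right[symmetric] sum_map_kernel)
    finally show ?thesis by (simp add: wz_rate_eq_slices[OF A ps])
  qed
  finally show "optimal_value (wz_problem p d D) \<le> ereal (wz_rate (wz_law p W V))" .
qed

text \<open>The test channel itself serves as p(u|x): U is a code for the map, and the decoder
  evaluates the decoded map at \<open>s\<close>.\<close>

lemma wyner_ziv_le_optimal_value:
  fixes p :: "('x::finite \<times> 's::finite) pmf" and d :: "'x \<Rightarrow> 'r::finite \<Rightarrow> real"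
  assumes ps: "\<And>s. 0 < prob_s p s"
  shows "wyner_ziv p d D \<le> optimal_value (wz_problem p d D)"
  unfolding optimal_value_def
proof (rule INF_greatest)
  fix q :: "real^('s \<Rightarrow> 'r)^'x" assume "q \<in> feasible (wz_problem p d D)"
  then have q: "\<And>x t. 0 \<le> q $ x $ t" and D: "wz_distortion p d q \<le> D"
    and q1: "\<And>x. (\<Sum>t\<in>UNIV. q $ x $ t) = 1"
    by (auto simp: feasible_wz_problem_iff)
  \<comment> \<open>Auxiliary alphabets live in the naturals, so the finitely many maps are numbered
    injectively.\<close>
  define e :: "('s \<Rightarrow> 'r) \<Rightarrow> nat" where "e = to_nat_on UNIV"
  have e: "inj e" unfolding e_def by (intro inj_on_to_nat_on countable_finite) simp
  define q' where "q' x = embed_pmf (\<lambda>t. q $ x $ t)" for x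
  have q': "pmf (q' x) t = q $ x $ t" for x t
    unfolding q'_def using q q1
    by (intro pmf_embed_pmf) (auto simp: nn_integral_count_space_finite sum_ennreal)
  define W where "W x = map_pmf e (q' x)" for x
  have We: "pmf (W x) (e t) = q $ x $ t" for x t
    using e by (simp add: W_def pmf_map_inj' q')
  \<comment> \<open>The decoder is deterministic; off the range of \<open>e\<close>, where
    \<open>W\<close> puts no mass, its value is arbitrary.\<close>
  define V where "V u s = return_pmf (inv e u s)" for u s
  have V: "V (e t) s = return_pmf (t s)" for t s
    using e by (simp add: V_def inv_f_f)
  have A: "finite (range e)" "\<And>x. set_pmf (W x) \<subseteq> range e" by (auto simp: W_def)
  have "measure_pmf.expectation (wz_law p W V) (\<lambda>(x, s, u, r). d x r) = wz_distortion p d q"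
    unfolding expected_distortion_wz_law[OF A] wz_distortion_def
    by (simp add: sum.reindex[OF e] We V pmf_return indicator_def if_distrib cong: if_cong)
  moreover have "wz_rate (wz_law p W V) = objective (wz_problem p d D) q"
    by (simp add: wz_rate_eq_slices[OF A ps] sum.reindex[OF e] We wz_problem_def wz_objective_eq_slices)
  moreover have "finite (set_pmf (W x))" for x
    using A finite_subset by blast
  ultimately show "wyner_ziv p d D \<le> ereal (objective (wz_problem p d D) q)"
    unfolding wyner_ziv_def using D by (intro Inf_lower) (auto intro!: exI[of _ W] exI[of _ V])
qed

theorem theorem3:
  fixes p :: "('x::finite \<times> 's::finite) pmf"
    and d :: "'x \<Rightarrow> 'r::finite \<Rightarrow> real"
    and D :: real
  assumes px: "\<And>x. 0 < prob_x p x"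
    and ps: "\<And>s. 0 < prob_s p s"
    and d: "\<And>x r. 0 \<le> d x r"
  shows "optimal_value (wz_problem p d D) = wyner_ziv p d D
    \<and> gp_convex_form (wz_gp p d D)
    \<and> wz_dual_equiv_gp p d D
    \<and> (slater (wz_problem p d D) \<longrightarrow>
         strong_duality (wz_problem p d D) \<and> wz_gp_value p d D = wyner_ziv p d D)"
proof -
  have R: "optimal_value (wz_problem p d D) = wyner_ziv p d D"
    using ps by (intro antisym optimal_value_le_wyner_ziv wyner_ziv_le_optimal_value)
  moreover have "strong_duality (wz_problem p d D) \<and> wz_gp_value p d D = wyner_ziv p d D"
    if "slater (wz_problem p d D)"
    using wz_strong_duality[OF ps that] wz_dual_value_eq[OF px ps, of d D] R
    by (simp add: strong_duality_def)
  ultimately show ?thesis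
    using gp_convex_form_wz_gp wz_dual_equiv_gp[OF px ps] by blast
qed

end
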